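(* Let $K\subset\hat{\mathbb{C}}$ be a compactum and $x\ne y\in K$. Then $(x,y)\in\overline{R_K}$ if and only if, for every $0<r<\frac{\rho(x,y)}{2}$, the set $K\setminus(D_r(x)\cup D_r(y))$ has infinitely many components intersecting both $\partial D_r(x)$ and $\partial D_r(y)$.
   Context: $\rho$ is the spherical distance on $\hat{\mathbb{C}}$ and $D_r(z)$ is the open $\rho$-ball of radius $r$ centered at $z$. For disjoint simple closed curves $J_1,J_2\subset\hat{\mathbb{C}}$, $U(J_1,J_2)$ is the component of $\hat{\mathbb{C}}\setminus(J_1\cup J_2)$ with boundary $J_1\cup J_2$. The Schönflies relation $R_K\subset K\times K$: $x\ne y$ satisfy $(x,y)\in R_K$ if there exist disjoint simple closed curves $J_1\ni x$, $J_2\ni y$ such that $\overline{U(J_1,J_2)}\cap K$ contains an infinite sequence of distinct components $P_n$ each meeting both $J_1$ and $J_2$ whose Hausdorff limit contains $\{x,y\}$. $\overline{R_K}$ is the closure of $R_K$ in $K\times K$. *)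

theory Defs
  imports "HOL-Analysis.Analysis"
begin

text \<open>Model of the Riemann sphere: the unit sphere S2 in R^3 (homeomorphic via
  stereographic projection).  rho is the spherical (great-circle) distance.\<close>

abbreviation S2 :: "(real^3) set" where
  "S2 \<equiv> sphere 0 1"

definition rho :: "real^3 \<Rightarrow> real^3 \<Rightarrow> real" where
  "rho x y = arccos (x \<bullet> y)"

definition Dball :: "real \<Rightarrow> real^3 \<Rightarrow> (real^3) set" where
  "Dball r z = {w \<in> S2. rho z w < r}"

definition sbd :: "(real^3) set \<Rightarrow> (real^3) set" where
  "sbd A = (top_of_set S2) frontier_of A"

definition simple_closed_curve :: "(real^3) set \<Rightarrow> bool" where
  "simple_closed_curve J \<longleftrightarrow>
     (\<exists>g. simple_path g \<and> pathfinish g = pathstart g \<and> path_image g = J)"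

definition is_U :: "(real^3) set \<Rightarrow> (real^3) set \<Rightarrow> (real^3) set \<Rightarrow> bool" where
  "is_U J1 J2 U \<longleftrightarrow> U \<in> components (S2 - (J1 \<union> J2)) \<and> sbd U = J1 \<union> J2"

definition hausdorff_lim :: "(nat \<Rightarrow> (real^3) set) \<Rightarrow> (real^3) set \<Rightarrow> bool" where
  "hausdorff_lim P L \<longleftrightarrow> compact L \<and> L \<noteq> {} \<and>
     (\<forall>e>0. eventually (\<lambda>n. (\<forall>a\<in>P n. \<exists>b\<in>L. rho a b < e) \<and>
                              (\<forall>b\<in>L. \<exists>a\<in>P n. rho a b < e)) sequentially)"

definition schoenflies_rel :: "(real^3) set \<Rightarrow> ((real^3) \<times> (real^3)) set" where
  "schoenflies_rel K = {(x, y) | x y. x \<in> K \<and> y \<in> K \<and> x \<noteq> y \<and>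
     (\<exists>J1 J2 U. J1 \<subseteq> S2 \<and> J2 \<subseteq> S2 \<and>
        simple_closed_curve J1 \<and> simple_closed_curve J2 \<and> J1 \<inter> J2 = {} \<and>
        x \<in> J1 \<and> y \<in> J2 \<and> is_U J1 J2 U \<and>
        (\<exists>P :: nat \<Rightarrow> (real^3) set. inj P \<and>
           (\<forall>n. P n \<in> components (closure U \<inter> K) \<and> P n \<inter> J1 \<noteq> {} \<and> P n \<inter> J2 \<noteq> {}) \<and>
           (\<exists>L. hausdorff_lim P L \<and> {x, y} \<subseteq> L)))}"

end

theory Submission
  imports Defs "HOL-Complex_Analysis.Great_Picard"
begin

text \<open>If the annulus condition holds for all small \<open>r\<close>, the two circles are admissible curves, and
  Blaschke selection yields a pair of the relation on them; letting \<open>r \<rightarrow> 0\<close> gives one direction.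

  Conversely, let \<open>(u, v)\<close> be in the relation, witnessed by components \<open>P\<^sub>n\<close> of \<open>K\<close> in the closed
  annulus \<open>A\<close> between \<open>J\<^sub>1\<close> and \<open>J\<^sub>2\<close>. Each \<open>P\<^sub>n\<close> crosses from the cap at \<open>x\<close> to the cap at \<open>y\<close>. If only
  finitely many components of \<open>K\<close> outside the caps crossed, one of them would contain crossing pieces of
  infinitely many \<open>P\<^sub>n\<close>; since the \<open>P\<^sub>n\<close> are disconnected from each other within \<open>A\<close>, this
  component must leave \<open>A\<close>, so boundary bumping joins each of these pieces inside \<open>A\<close> to \<open>J\<^sub>1\<close>, say,
  at points outside the caps which accumulate at some \<open>p \<in> J\<^sub>1\<close>. Three of the pieces would then be
  disjoint continua touching three disjoint connected sets: small discs around \<open>u\<close> and \<open>v\<close>, and the part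
  near \<open>p\<close> of the complementary domain of \<open>J\<^sub>1\<close> that misses \<open>A\<close>. This contradicts the
  nonplanarity of \<open>K\<^bsub>3,3\<^esub>\<close>, which is proved here in the form of a statement on theta curves.\<close>

section \<open>Theta curves and Jordan domains\<close>

lemma connected_subset_side:
  assumes "connected T" "open W" "open S" "W \<inter> S = {}" "T \<subseteq> W \<union> S" "\<not> T \<subseteq> W"
  shows "T \<subseteq> S"
  using connectedD[OF assms(1-3)] assms(4-6) by blast

text \<open>Which of the two Jordan domains contains \<open>B\<close> does not matter later, so
  inside and outside are hidden behind the names \<open>W\<close> and \<open>S\<close>. The
  connected set \<open>B\<close> cannot meet both; the frontier is recorded for the side away from
  \<open>B\<close>.\<close>

lemma simple_closed_curve_sides:
  fixes g :: "real \<Rightarrow> complex"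
  assumes "simple_path g" "pathfinish g = pathstart g"
    and "connected B" "B \<inter> path_image g = {}" "B \<noteq> {}"
  obtains W S where "W \<union> S = - path_image g" "W \<inter> S = {}" "connected W" "connected S"
    "open W" "open S" "frontier S = path_image g" "B \<subseteq> W" "S \<noteq> {}"
proof -
  note J = Jordan_inside_outside[OF assms(1,2)]
  have cl: "closed (path_image g)"
    by (simp add: assms(1) closed_simple_path_image)
  have o: "open (inside (path_image g))" "open (outside (path_image g))"
    by (simp_all add: cl open_inside open_outside)
  have "B \<subseteq> inside (path_image g) \<or> B \<subseteq> outside (path_image g)"
  proof -
    have "B \<subseteq> inside (path_image g) \<union> outside (path_image g)"
      using assms(4) J by blast
    then show ?thesis
      using connected_subset_side[OF assms(3) o] J by blast
  qed
  then show thesis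
  proof
    assume "B \<subseteq> inside (path_image g)"
    with J o show thesis
      by (intro that[of "inside (path_image g)" "outside (path_image g)"]) blast+
  next
    assume "B \<subseteq> outside (path_image g)"
    with J o show thesis
      by (intro that[of "outside (path_image g)" "inside (path_image g)"]) blast+
  qed
qed

text \<open>The idea: let \<open>S\<^sub>2\<close> be the side of \<open>c\<^sub>0 \<union> c\<^sub>1\<close> not containing \<open>T\<close>. It misses \<open>c\<^sub>2\<close> and lies on
  the same side as \<open>T\<close> of the two other closed curves; these meet in the connected set \<open>c\<^sub>2\<close>, so
  Janiszewski's theorem joins \<open>S\<^sub>2\<close> to \<open>T\<close> in the complement of all three arcs.\<close>

lemma arcs_no_theta_face:
  fixes c0 c1 c2 :: "real \<Rightarrow> complex"
  assumes arc: "arc c0" "arc c1" "arc c2"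
    and st: "pathstart c0 = a" "pathstart c1 = a" "pathstart c2 = a"
    and fi: "pathfinish c0 = b" "pathfinish c1 = b" "pathfinish c2 = b"
    and int: "path_image c0 \<inter> path_image c1 = {a,b}" "path_image c0 \<inter> path_image c2 = {a,b}"
      "path_image c1 \<inter> path_image c2 = {a,b}"
    and T: "connected T" "T \<noteq> {}" "T \<inter> (path_image c0 \<union> path_image c1 \<union> path_image c2) = {}"
    and V: "connected V0" "connected V1" "connected V2"
      "V0 \<inter> T \<noteq> {}" "V1 \<inter> T \<noteq> {}" "V2 \<inter> T \<noteq> {}"
      "V0 \<inter> path_image c0 \<noteq> {}" "V1 \<inter> path_image c1 \<noteq> {}" "V2 \<inter> path_image c2 \<noteq> {}"
      "V0 \<inter> (path_image c1 \<union> path_image c2) = {}"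
      "V1 \<inter> (path_image c0 \<union> path_image c2) = {}"
      "V2 \<inter> (path_image c0 \<union> path_image c1) = {}"
  shows False
proof -
  define C0 C1 C2 where "C0 = path_image c0" and "C1 = path_image c1" and "C2 = path_image c2"
  note C_defs = C0_def C1_def C2_def
  have "a \<noteq> b"
    using arc(1) arc_distinct_ends st fi by metis
  have ab: "a \<in> C0" "b \<in> C0" "a \<in> C1" "b \<in> C1" "a \<in> C2" "b \<in> C2"
    using int by (auto simp: C_defs)
  have endless: "connected (path_image c - {a,b})" "path_image c - {a,b} \<noteq> {}"
    if "arc c" "pathstart c = a" "pathfinish c = b" for c :: "real \<Rightarrow> complex"
    using connected_simple_path_endless[of c] nonempty_simple_path_endless[of c] that
    by (auto simp: arc_imp_simple_path)
  \<comment> \<open>Stated for an arbitrary labelling of the three arcs, so that one proof serves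
    the three closed curves.\<close>
  have sides: "\<exists>W S. W \<union> S = - (path_image c \<union> path_image c') \<and> W \<inter> S = {} \<and> connected W
      \<and> connected S \<and> open W \<and> open S \<and> frontier S = path_image c \<union> path_image c' \<and> T \<subseteq> W
      \<and> path_image c'' - {a,b} \<subseteq> W \<and> S \<noteq> {}"
    if c: "arc c" "arc c'" "arc c''" "pathstart c = a" "pathstart c' = a" "pathstart c'' = a"
      "pathfinish c = b" "pathfinish c' = b" "pathfinish c'' = b"
      "path_image c \<inter> path_image c' = {a,b}" "path_image c \<inter> path_image c'' = {a,b}"
      "path_image c' \<inter> path_image c'' = {a,b}"
      "T \<inter> path_image c = {}" "T \<inter> path_image c' = {}"
      "connected V" "V \<inter> T \<noteq> {}" "V \<inter> path_image c'' \<noteq> {}"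
      "V \<inter> (path_image c \<union> path_image c') = {}"
    for c c' c'' :: "real \<Rightarrow> complex" and V
  proof -
    \<comment> \<open>The bridge \<open>V\<close> ties \<open>T\<close> to the open arc of
      \<open>c''\<close>, so all of them lie on one side of the closed curve formed by
      \<open>c\<close> and \<open>c'\<close>.\<close>
    define B where "B = T \<union> V \<union> (path_image c'' - {a,b})"
    have "V \<inter> (path_image c'' - {a,b}) \<noteq> {}"
      using c(10,17,18) by blast
    then have "connected B"
      unfolding B_def using c(15,16) T(1) endless(1)[OF c(3,6,9)]
      by (intro connected_Un) blast+
    moreover have "simple_path (c +++ reversepath c')"
      using c(1,2,4,5,7,8,10) by (intro simple_path_join_loop) (auto simp: arc_reversepath)
    moreover have pi: "path_image (c +++ reversepath c') = path_image c \<union> path_image c'"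
      using c(7,8) by (simp add: path_image_join)
    moreover have "B \<inter> path_image (c +++ reversepath c') = {}"
      unfolding B_def pi using c(11-14,18) by blast
    moreover have "B \<noteq> {}"
      using T(2) by (simp add: B_def)
    moreover have "pathfinish (c +++ reversepath c') = pathstart (c +++ reversepath c')"
      using c(4,5) by simp
    ultimately obtain W S where "W \<union> S = - path_image (c +++ reversepath c')" "W \<inter> S = {}"
        "connected W" "connected S" "open W" "open S"
        "frontier S = path_image (c +++ reversepath c')" "B \<subseteq> W" "S \<noteq> {}"
      using simple_closed_curve_sides by metis
    then show ?thesis
      unfolding pi by (intro exI[of _ W] exI[of _ S]) (auto simp: B_def)
  qed
  have T': "T \<inter> path_image c0 = {}" "T \<inter> path_image c1 = {}" "T \<inter> path_image c2 = {}"
    using T(3) by blast+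
  have int': "path_image c1 \<inter> path_image c0 = {a,b}" "path_image c2 \<inter> path_image c0 = {a,b}"
      "path_image c2 \<inter> path_image c1 = {a,b}"
    using int by (simp_all add: Int_commute)
  \<comment> \<open>The index names the arc left out of the closed curve. In this proof
    \<open>S2\<close> is a Jordan domain in the plane and shadows the sphere.\<close>
  obtain W2 S2 where 2: "W2 \<union> S2 = - (C0 \<union> C1)" "W2 \<inter> S2 = {}" "connected W2" "connected S2"
      "open W2" "open S2" "frontier S2 = C0 \<union> C1" "T \<subseteq> W2" "C2 - {a,b} \<subseteq> W2" "S2 \<noteq> {}"
    using sides[OF arc(1) arc(2) arc(3) st(1) st(2) st(3) fi(1) fi(2) fi(3)
        int(1) int(2) int(3) T'(1) T'(2) V(3) V(6) V(9) V(12)]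
    unfolding C_defs by blast
  obtain W1 S1 where 1: "W1 \<union> S1 = - (C0 \<union> C2)" "W1 \<inter> S1 = {}" "connected W1" "connected S1"
      "open W1" "open S1" "frontier S1 = C0 \<union> C2" "T \<subseteq> W1" "C1 - {a,b} \<subseteq> W1" "S1 \<noteq> {}"
    using sides[OF arc(1) arc(3) arc(2) st(1) st(3) st(2) fi(1) fi(3) fi(2)
        int(2) int(1) int'(3) T'(1) T'(3) V(2) V(5) V(8) V(11)]
    unfolding C_defs by blast
  obtain W0 S0 where 0: "W0 \<union> S0 = - (C1 \<union> C2)" "W0 \<inter> S0 = {}" "connected W0" "connected S0"
      "open W0" "open S0" "frontier S0 = C1 \<union> C2" "T \<subseteq> W0" "C0 - {a,b} \<subseteq> W0" "S0 \<noteq> {}"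
    using sides[OF arc(2) arc(3) arc(1) st(2) st(3) st(1) fi(2) fi(3) fi(1)
        int(3) int'(1) int'(2) T'(2) T'(3) V(1) V(4) V(7) V(10)]
    unfolding C_defs by blast
  have cl: "closed C0" "closed C1" "closed C2" "compact C0" "compact C1" "compact C2" "connected C2"
    using arc by (auto simp: C_defs closed_arc_image compact_arc_image connected_arc_image)
  have S2_off: "S2 \<inter> (C0 \<union> C1 \<union> C2) = {}"
    using 2 ab by blast
  \<comment> \<open>Were \<open>S2\<close> on the far side \<open>S1\<close>, its frontier arc
    \<open>C1\<close> would lie in the closure of \<open>S1\<close>, whereas the open arc of
    \<open>C1\<close> is a nonempty part of \<open>W1\<close>. The same argument with
    \<open>C0\<close> gives \<open>sub0\<close>.\<close>
  have sub1: "S2 \<subseteq> W1"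
  proof (rule ccontr)
    assume "\<not> S2 \<subseteq> W1"
    then have "S2 \<subseteq> S1"
      using S2_off by (intro connected_subset_side[OF 2(4) 1(5,6,2)]) (use 1(1) in blast)+
    then have "C1 \<subseteq> closure S1"
      using 2(7) by (metis closure_mono closure_Un_frontier Un_upper2 le_supE subset_trans)
    then have "C1 \<subseteq> S1 \<union> (C0 \<union> C2)"
      using 1(7) by (simp add: closure_Un_frontier)
    moreover have "C1 - {a,b} \<noteq> {}" "C1 \<inter> C0 = {a,b}" "C1 \<inter> C2 = {a,b}"
      using endless(2)[OF arc(2) st(2) fi(2)] int int' unfolding C_defs by blast+
    ultimately show False
      using 1(2,9) by blast
  qed
  have sub0: "S2 \<subseteq> W0"
  proof (rule ccontr)
    assume "\<not> S2 \<subseteq> W0"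
    then have "S2 \<subseteq> S0"
      using S2_off by (intro connected_subset_side[OF 2(4) 0(5,6,2)]) (use 0(1) in blast)+
    then have "C0 \<subseteq> closure S0"
      using 2(7) by (metis closure_mono closure_Un_frontier Un_upper2 le_supE subset_trans)
    then have "C0 \<subseteq> S0 \<union> (C1 \<union> C2)"
      using 0(7) by (simp add: closure_Un_frontier)
    moreover have "C0 - {a,b} \<noteq> {}" "C0 \<inter> C1 = {a,b}" "C0 \<inter> C2 = {a,b}"
      using endless(2)[OF arc(1) st(1) fi(1)] int int' unfolding C_defs by blast+
    ultimately show False
      using 0(2,9) by blast
  qed
  obtain p w where p: "p \<in> S2" and w: "w \<in> T"
    using 2(10) T(2) by blast
  have "connected_component (- (C0 \<union> C2)) p w"
    unfolding connected_component_def using 1(1,3,8) p w sub1 by (intro exI[of _ W1]) blast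
  moreover have "connected_component (- (C1 \<union> C2)) p w"
    unfolding connected_component_def using 0(1,3,8) p w sub0 by (intro exI[of _ W0]) blast
  moreover have "(C0 \<union> C2) \<inter> (C1 \<union> C2) = C2"
    using int ab unfolding C_defs by blast
  ultimately have "connected_component (- ((C0 \<union> C2) \<union> (C1 \<union> C2))) p w"
    using Janiszewski[of "C0 \<union> C2" "C1 \<union> C2" p w] cl by (simp add: compact_Un closed_Un)
  then obtain Z where Z: "connected Z" "Z \<subseteq> - ((C0 \<union> C2) \<union> (C1 \<union> C2))" "p \<in> Z" "w \<in> Z"
    by (auto simp: connected_component_def)
  \<comment> \<open>The connected set \<open>Z\<close> avoids \<open>C0\<close> and
    \<open>C1\<close>, yet contains \<open>p\<close> from one side of their union and
    \<open>w\<close> from the other.\<close>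
  then have "Z \<subseteq> W2 \<union> S2" using 2(1) by blast
  then show False
    using connected_subset_side[OF Z(1) 2(5,6,2)] Z(3,4) 2(2,8) p w by blast
qed

text \<open>Janiszewski's theorem for the curve and the complement of \<open>N\<close> together with the closed subarc \<open>F\<close>
  away from \<open>p\<close>: these two sets meet exactly in \<open>F\<close>.\<close>

lemma Jordan_inside_locally_connected:
  fixes g :: "real \<Rightarrow> complex"
  assumes g: "simple_path g" "pathfinish g = pathstart g"
    and p: "p \<in> path_image g" and N: "open N" "p \<in> N"
  obtains Y N' where "open Y" "connected Y" "Y \<subseteq> N \<inter> inside (path_image g)"
    "open N'" "p \<in> N'" "N' \<subseteq> N" "path_image g \<inter> N' \<subseteq> closure Y"
proof -
  obtain u where u: "u \<in> {0..1}" "g u = p"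
    using p by (auto simp: path_image_def)
  \<comment> \<open>Rotating the parametrization puts \<open>p\<close> at both ends of the unit
    interval, so that cutting out a stretch of the curve around \<open>p\<close> leaves the single
    arc \<open>F\<close>.\<close>
  define h where "h = shiftpath u g"
  have h: "simple_path h" "path_image h = path_image g" "h 0 = p" "h 1 = p"
    unfolding h_def using simple_path_shiftpath[of g u] path_image_shiftpath[of u g] g u
      pathstart_shiftpath[of u g] pathfinish_shiftpath[of u g]
    by (auto simp: pathstart_def pathfinish_def)
  have cont: "continuous_on {0..1} h"
    using h(1) by (simp add: simple_path_def path_def)
  have "\<exists>e>0. e < 1/2 \<and> (\<forall>t\<in>{0..1}. t < e \<or> t > 1 - e \<longrightarrow> h t \<in> N)"
  proof -
    obtain d where d: "d > 0" "ball p d \<subseteq> N"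
      using N open_contains_ball by blast
    obtain e0 where e0: "e0 > 0" "\<And>t. t \<in> {0..1} \<Longrightarrow> dist t 0 < e0 \<Longrightarrow> dist (h t) (h 0) < d"
      using cont d(1) unfolding continuous_on_iff by (metis atLeastAtMost_iff order_refl zero_le_one)
    obtain e1 where e1: "e1 > 0" "\<And>t. t \<in> {0..1} \<Longrightarrow> dist t 1 < e1 \<Longrightarrow> dist (h t) (h 1) < d"
      using cont d(1) unfolding continuous_on_iff by (metis atLeastAtMost_iff order_refl zero_le_one)
    show ?thesis
    proof (intro exI[of _ "min (min e0 e1) (1/4)"] conjI ballI impI)
      fix t :: real assume t: "t \<in> {0..1}" "t < min (min e0 e1) (1/4) \<or> t > 1 - min (min e0 e1) (1/4)"
      then have "dist t 0 < e0 \<or> dist t 1 < e1"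
        by (auto simp: dist_real_def min_def split: if_splits)
      then have "dist (h t) p < d"
        using e0(2) e1(2) t h by metis
      then show "h t \<in> N"
        using d(2) by (auto simp: dist_commute)
    qed (use e0 e1 in auto)
  qed
  then obtain e where e: "e > 0" "e < 1/2" "\<And>t. t \<in> {0..1} \<Longrightarrow> t < e \<or> t > 1 - e \<Longrightarrow> h t \<in> N"
    by blast
  define F where "F = h ` {e..1-e}"
  have sub: "{e..1-e} \<subseteq> {0..1}"
    using e by auto
  have F: "compact F" "connected F"
    unfolding F_def using cont sub
    by (meson compact_Icc compact_continuous_image continuous_on_subset connected_Icc connected_continuous_image)+
  have FJ: "F \<subseteq> path_image g"
    using sub h(2) by (force simp: F_def path_image_def)
  have JF: "path_image g - N \<subseteq> F"
  proof
    fix q assume q: "q \<in> path_image g - N"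
    then obtain t where "t \<in> {0..1}" "q = h t"
      using h(2) by (metis Diff_iff imageE path_image_def)
    then show "q \<in> F"
      using e(3)[of t] q unfolding F_def by force
  qed
  have pF: "p \<notin> F"
  proof
    assume "p \<in> F"
    then obtain t where t: "t \<in> {e..1-e}" "h t = p"
      by (auto simp: F_def)
    with h e have "t = 0 \<or> t = 1"
      unfolding simple_path_def loop_free_def
      by (metis atLeastAtMost_iff sub subsetD order_refl zero_le_one)
    with t e show False by auto
  qed
  obtain d where d: "d > 0" "ball p d \<subseteq> N - F"
    using N pF F(1) by (metis DiffI compact_imp_closed open_Diff open_contains_ball)
  define In where "In = inside (path_image g)"
  note J = Jordan_inside_outside[OF g, folded In_def]
  have clJ: "closed (path_image g)" "compact (path_image g)"
    by (simp_all add: closed_simple_path_image compact_simple_path_image g(1))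
  have p_cl: "path_image g \<subseteq> closure In"
    using J by (metis closure_Un_frontier Un_upper2)
  then obtain a0 where a0: "a0 \<in> In" "a0 \<in> ball p d"
    using p d(1) by (metis closure_approachable dist_commute mem_ball subsetD)
  \<comment> \<open>Removing \<open>- N\<close> together with the curve confines \<open>Y\<close> to
    \<open>N\<close>.\<close>
  define Y where "Y = connected_component_set (- (path_image g \<union> (- N \<union> F))) a0"
  \<comment> \<open>Two points of \<open>In\<close> near \<open>p\<close> are joined off the curve
    within \<open>In\<close>, and off \<open>- N\<close> and \<open>F\<close> within the ball. The
    removed sets meet in the connected arc \<open>F\<close>, so the points are joined off both, and
    one component takes in everything of \<open>In\<close> near \<open>p\<close>.\<close>
  have near: "In \<inter> ball p d \<subseteq> Y"
  proof
    fix b assume b: "b \<in> In \<inter> ball p d"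
    have "connected_component (- path_image g) a0 b"
      unfolding connected_component_def using b a0 J
      by (intro exI[of _ In]) (use In_def inside_no_overlap in blast)
    moreover have "connected_component (- (- N \<union> F)) a0 b"
      unfolding connected_component_def using b a0 d
      by (intro exI[of _ "ball p d"]) auto
    moreover have "path_image g \<inter> (- N \<union> F) = F"
      using FJ JF by blast
    moreover have "closed (- N \<union> F)"
      using N F by (simp add: closed_Compl compact_imp_closed closed_Un)
    ultimately show "b \<in> Y"
      unfolding Y_def using Janiszewski[of "path_image g" "- N \<union> F" a0 b] clJ F by simp
  qed
  have clF: "closed (- N \<union> F)"
    using N F by (simp add: closed_Compl compact_imp_closed closed_Un)
  have Yc: "connected Y" "open Y"
    unfolding Y_def by (intro open_connected_component open_Compl closed_Un clJ clF connected_connected_component)+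
  have Ys: "Y \<subseteq> - (path_image g \<union> (- N \<union> F))"
    unfolding Y_def by (rule connected_component_subset)
  have "a0 \<in> Y"
    using near a0 by blast
  have "Y \<subseteq> In"
  proof (rule connected_subset_side[OF Yc(1), of "outside (path_image g)"])
    show "open (outside (path_image g))" "open In"
      using clJ by (auto simp: In_def open_inside open_outside)
    show "outside (path_image g) \<inter> In = {}" "Y \<subseteq> outside (path_image g) \<union> In"
      using Ys J by auto
    show "\<not> Y \<subseteq> outside (path_image g)"
      using \<open>a0 \<in> Y\<close> a0 J by blast
  qed
  moreover have "path_image g \<inter> ball p d \<subseteq> closure Y"
  proof -
    have "path_image g \<inter> ball p d \<subseteq> ball p d \<inter> closure In"
      using p_cl by blast
    also have "\<dots> \<subseteq> closure (ball p d \<inter> In)"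
      by (intro open_Int_closure_subset) auto
    also have "\<dots> \<subseteq> closure Y"
      using near by (intro closure_mono) auto
    finally show ?thesis .
  qed
  ultimately show thesis
    using that[of Y "ball p d"] Yc Ys d unfolding In_def by auto
qed

section \<open>Separation of continua\<close>

text \<open>In a compact Hausdorff space two closed sets that no connected set joins are separated
  by a clopen set (the cut wire fence theorem). The two clopen parts of the compact set
  \<open>M\<close> are compact again.\<close>

lemma compact_separation_between:
  fixes M :: "'a::euclidean_space set"
  assumes "compact M" "closed S" "closed T"
    and no: "\<And>C. C \<in> components M \<Longrightarrow> C \<inter> S = {} \<or> C \<inter> T = {}"
  obtains M1 M2 where "compact M1" "compact M2" "M1 \<union> M2 = M" "M1 \<inter> M2 = {}"
    "M \<inter> S \<subseteq> M1" "M \<inter> T \<subseteq> M2"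
proof -
  have "separated_between (top_of_set M) (M \<inter> S) (M \<inter> T)"
  proof (rule cut_wire_fence_theorem)
    show "compact_space (top_of_set M)" "Hausdorff_space (top_of_set M)"
      using assms by (auto simp: compact_space_subtopology Hausdorff_space_subtopology)
    show "closedin (top_of_set M) (M \<inter> S)" "closedin (top_of_set M) (M \<inter> T)"
      using assms by (auto simp: closedin_closed_Int)
    fix C assume C: "connectedin (top_of_set M) C"
    then have C: "connected C" "C \<subseteq> M"
      by (auto simp: connectedin_subtopology)
    show "disjnt C (M \<inter> S) \<or> disjnt C (M \<inter> T)"
    proof (cases "M = {}")
      case False
      then obtain C' where "C' \<in> components M" "C \<subseteq> C'"
        using C exists_component_superset by metis
      with no[of C'] show ?thesis
        by (auto simp: disjnt_iff)
    qed (auto simp: disjnt_iff)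
  qed
  then obtain U V where U: "openin (top_of_set M) U" "openin (top_of_set M) V" "U \<union> V = M"
      "disjnt U V" "M \<inter> S \<subseteq> U" "M \<inter> T \<subseteq> V"
    unfolding separated_between_def by (metis topspace_euclidean_subtopology)
  then have "M - V = U" "M - U = V"
    by (auto simp: disjnt_iff)
  then have "closedin (top_of_set M) U" "closedin (top_of_set M) V"
    using U by (metis closedin_diff closedin_topspace topspace_euclidean_subtopology)+
  then have "compact U" "compact V"
    using \<open>compact M\<close> closedin_compact by blast+
  with U show thesis
    by (intro that[of U V]) (auto simp: disjnt_iff)
qed

text \<open>If no component crossed, the part of \<open>P\<close> outside \<open>D\<close> and
  \<open>E\<close> would split into two compact pieces, one holding its contacts with
  \<open>closure D\<close>, the other those with \<open>closure E\<close>. Adding the part of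
  \<open>P\<close> in each closure to the corresponding piece would disconnect
  \<open>P\<close>.\<close>

lemma continuum_crossing_component:
  fixes P :: "'a::euclidean_space set"
  assumes P: "compact P" "connected P" and D: "open D" "open E" "closure D \<inter> closure E = {}"
    and "P \<inter> D \<noteq> {}" "P \<inter> E \<noteq> {}"
  obtains Q where "Q \<in> components (P - (D \<union> E))" "Q \<inter> closure D \<noteq> {}" "Q \<inter> closure E \<noteq> {}"
proof (rule ccontr)
  assume "\<not> thesis"
  with that have no: "Q \<inter> closure D = {} \<or> Q \<inter> closure E = {}" if "Q \<in> components (P - (D \<union> E))" for Q
    using \<open>Q \<in> _\<close> by blast
  have c: "compact (P - (D \<union> E))"
    using P D by (intro compact_diff open_Un)
  obtain M1 M2 where M: "compact M1" "compact M2" "M1 \<union> M2 = P - (D \<union> E)" "M1 \<inter> M2 = {}"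
      "(P - (D \<union> E)) \<inter> closure D \<subseteq> M1" "(P - (D \<union> E)) \<inter> closure E \<subseteq> M2"
    using compact_separation_between[OF c closed_closure closed_closure no] by blast
  have "closed (M1 \<union> closure D \<inter> P)" "closed (M2 \<union> closure E \<inter> P)"
    by (intro closed_Un closed_Int compact_imp_closed M P closed_closure)+
  moreover have "P \<subseteq> (M1 \<union> closure D \<inter> P) \<union> (M2 \<union> closure E \<inter> P)"
    using M(3) closure_subset by blast
  moreover have "(M1 \<union> closure D \<inter> P) \<inter> (M2 \<union> closure E \<inter> P) \<inter> P = {}"
    using M D(3) closure_subset[of D] closure_subset[of E] by auto
  moreover have "(M1 \<union> closure D \<inter> P) \<inter> P \<noteq> {}" "(M2 \<union> closure E \<inter> P) \<inter> P \<noteq> {}"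
    using assms(6,7) closure_subset[of D] closure_subset[of E] by blast+
  ultimately show False
    using P(2) unfolding connected_closed by blast
qed

text \<open>Boundary bumping. A component missing the frontier could be enclosed in a compact piece
  of \<open>C \<inter> A\<close> that stays off the frontier. Such a piece would be relatively
  clopen in the connected set \<open>C\<close>, and proper because \<open>C\<close> leaves
  \<open>A\<close>.\<close>

lemma component_meets_frontier:
  fixes C :: "'a::euclidean_space set"
  assumes C: "compact C" "connected C" and A: "closed A" "\<not> C \<subseteq> A"
    and C': "C' \<in> components (C \<inter> A)"
  shows "C' \<inter> frontier A \<noteq> {}"
proof
  assume no: "C' \<inter> frontier A = {}"
  have c: "compact (C \<inter> A)" "compact C'"
    using C A C' by (auto intro: compact_components)
  have "Q \<inter> C' = {} \<or> Q \<inter> frontier A = {}" if "Q \<in> components (C \<inter> A)" for Q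
    using components_nonoverlap[OF that C'] no by auto
  then obtain M1 M2 where M: "compact M1" "compact M2" "M1 \<union> M2 = C \<inter> A" "M1 \<inter> M2 = {}"
      "(C \<inter> A) \<inter> C' \<subseteq> M1" "(C \<inter> A) \<inter> frontier A \<subseteq> M2"
    using compact_separation_between[OF c(1) compact_imp_closed[OF c(2)] frontier_closed, of A] by metis
  have fr: "frontier A = A - interior A"
    using A by (simp add: frontier_def)
  have "closed M1" "closed (M2 \<union> (C - interior A))"
    by (intro closed_Un closed_Diff compact_imp_closed M C open_interior)+
  moreover have "C \<subseteq> M1 \<union> (M2 \<union> (C - interior A))"
    using M(3) interior_subset[of A] by blast
  moreover have "M1 \<inter> (M2 \<union> (C - interior A)) \<inter> C = {}"
    using M fr by blast
  moreover have "C' \<subseteq> C \<inter> A" "C' \<noteq> {}"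
    using C' in_components_subset in_components_nonempty by blast+
  then have "M1 \<inter> C \<noteq> {}"
    using M(5) by blast
  moreover have "(M2 \<union> (C - interior A)) \<inter> C \<noteq> {}"
    using A(2) interior_subset[of A] by blast
  ultimately show False
    using C(2) unfolding connected_closed by blast
qed

section \<open>Three continua touching three sets\<close>

text \<open>Merges finitely many distance bounds into one: the property passes to smaller positive
  numbers, so the minimum works.\<close>

lemma uniform_positive_bound:
  fixes Q :: "'a \<Rightarrow> real \<Rightarrow> bool"
  assumes "finite A" and ex: "\<And>a. a \<in> A \<Longrightarrow> \<exists>d>0. Q a d"
    and mono: "\<And>a d d'. a \<in> A \<Longrightarrow> Q a d \<Longrightarrow> 0 < d' \<Longrightarrow> d' \<le> d \<Longrightarrow> Q a d'"
  shows "\<exists>d>0. \<forall>a\<in>A. Q a d"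
  using assms
proof (induction A rule: finite_induct)
  case empty
  then show ?case by (intro exI[of _ 1]) auto
next
  case (insert b A)
  have "\<exists>d>0. \<forall>a\<in>A. Q a d"
    by (rule insert.IH) (use insert.prems in blast)+
  then obtain d where d: "d > 0" "\<And>a. a \<in> A \<Longrightarrow> Q a d" by blast
  obtain e where e: "e > 0" "Q b e"
    using insert.prems(1) by blast
  have "Q a (min d e)" if "a \<in> insert b A" for a
    using that insert.prems(2)[of a d "min d e"] insert.prems(2)[of a e "min d e"] d e by auto
  then show ?case
    using d(1) e(1) by (intro exI[of _ "min d e"]) auto
qed

lemma connected_union_balls:
  fixes X :: "'a::real_normed_vector set"
  assumes "connected X" "d > 0"
  shows "connected (\<Union>a\<in>X. ball a d)"
proof -
  have "connected (X \<union> \<Union>((\<lambda>a. ball a d) ` X))"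
    using assms by (intro connected_Un_UN) auto
  moreover have "X \<union> \<Union>((\<lambda>a. ball a d) ` X) = (\<Union>a\<in>X. ball a d)"
    using assms(2) by auto
  ultimately show ?thesis by simp
qed

lemma closed_segment_in_ball:
  fixes x t :: "'a::euclidean_space"
  assumes "q \<in> closed_segment x t" "dist x t = s" "s > 0"
  shows "q = t \<or> q \<in> ball x s"
proof -
  obtain l where l: "0 \<le> l" "l \<le> 1" "q = (1 - l) *\<^sub>R x + l *\<^sub>R t"
    using assms(1) by (auto simp: in_segment)
  have "x - q = l *\<^sub>R (x - t)"
    by (simp add: l(3) algebra_simps)
  then have "dist x q = l * s"
    using assms(2) l(1) by (simp add: dist_norm)
  then show ?thesis
    using l assms(3) by (cases "l = 1") (auto simp: mult_less_cancel_right2)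
qed

text \<open>The norm of \<open>x - q\<close> is both \<open>l * s\<close> and \<open>m * s\<close>,
  so the two parameters agree; distinct endpoints then force the common parameter to vanish.\<close>

lemma radial_segments_meet_at_center:
  fixes x t t' :: "'a::euclidean_space"
  assumes "dist x t = s" "dist x t' = s" "s > 0" "t \<noteq> t'"
    and "q \<in> closed_segment x t" "q \<in> closed_segment x t'"
  shows "q = x"
proof -
  obtain l where l: "0 \<le> l" "q = (1 - l) *\<^sub>R x + l *\<^sub>R t"
    using assms(5) by (auto simp: in_segment)
  obtain m where m: "0 \<le> m" "q = (1 - m) *\<^sub>R x + m *\<^sub>R t'"
    using assms(6) by (auto simp: in_segment)
  have a: "x - q = l *\<^sub>R (x - t)"
    by (simp add: l algebra_simps)
  have b: "x - q = m *\<^sub>R (x - t')"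
    by (simp add: m algebra_simps)
  have "norm (x - q) = l * s"
    by (subst a) (use assms(1) l(1) in \<open>simp add: dist_norm\<close>)
  moreover have "norm (x - q) = m * s"
    by (subst b) (use assms(2) m(1) in \<open>simp add: dist_norm\<close>)
  ultimately have "l * s = m * s"
    by metis
  then have "l = m"
    using assms(3) by simp
  then have "l = 0"
    using a b assms(4) by auto
  then show ?thesis
    using a by simp
qed

text \<open>The arcs of the theta curve run radially from \<open>x\<close> to \<open>X i\<close>, through a thin neighbourhood of \<open>X i\<close>, and
  radially on to \<open>y\<close>. The neighbourhood must be chosen after the connected set \<open>T\<close> inside \<open>Y\<close>, whereas the
  larger radius \<open>e\<close>, for which the neighbourhoods reach \<open>T\<close>, is chosen before it.\<close>

lemma no_three_continua_touching_three_sets: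
  fixes X :: "nat \<Rightarrow> complex set" and x y :: complex
  assumes X: "\<And>i. i < 3 \<Longrightarrow> compact (X i)" "\<And>i. i < 3 \<Longrightarrow> connected (X i)"
    and X_disj: "\<And>i j. i < 3 \<Longrightarrow> j < 3 \<Longrightarrow> i \<noteq> j \<Longrightarrow> X i \<inter> X j = {}"
    and s: "s > 0" "cball x s \<inter> cball y s = {}"
    and X_off: "\<And>i. i < 3 \<Longrightarrow> X i \<inter> ball x s = {}" "\<And>i. i < 3 \<Longrightarrow> X i \<inter> ball y s = {}"
    and X_touch: "\<And>i. i < 3 \<Longrightarrow> X i \<inter> cball x s \<noteq> {}" "\<And>i. i < 3 \<Longrightarrow> X i \<inter> cball y s \<noteq> {}"
    and Y: "open Y" "connected Y" "Y \<inter> (cball x s \<union> cball y s) = {}"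
    and Y_off: "\<And>i. i < 3 \<Longrightarrow> X i \<inter> Y = {}"
    and Y_touch: "\<And>i. i < 3 \<Longrightarrow> X i \<inter> closure Y - (cball x s \<union> cball y s) \<noteq> {}"
  shows False
proof -
  have "\<forall>i\<in>{..<3}. \<exists>t. t \<in> X i \<inter> cball x s"
    using X_touch(1) by blast
  then obtain t where t: "\<And>i. i < 3 \<Longrightarrow> t i \<in> X i" "\<And>i. i < 3 \<Longrightarrow> t i \<in> cball x s"
    by (metis IntE bchoice lessThan_iff)
  have "\<forall>i\<in>{..<3}. \<exists>u. u \<in> X i \<inter> cball y s"
    using X_touch(2) by blast
  then obtain u where u: "\<And>i. i < 3 \<Longrightarrow> u i \<in> X i" "\<And>i. i < 3 \<Longrightarrow> u i \<in> cball y s"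
    by (metis IntE bchoice lessThan_iff)
  have "\<forall>i\<in>{..<3}. \<exists>z. z \<in> X i \<inter> closure Y - (cball x s \<union> cball y s)"
    using Y_touch by blast
  then obtain z where z: "\<And>i. i < 3 \<Longrightarrow> z i \<in> X i \<inter> closure Y"
    by (metis DiffE bchoice lessThan_iff)
  \<comment> \<open>The chosen points lie in the closed discs but not in the open ones, hence on the
    circles. All other points of the radial segments ending there are in the open discs, which the
    continua avoid.\<close>
  have dt: "dist x (t i) = s" "dist y (u i) = s" if "i < 3" for i
    using t[OF that] u[OF that] X_off[OF that] by force+
  define R where "R = (\<lambda>i. closed_segment x (t i) \<union> closed_segment y (u i))"
  have segx: "q = t i \<or> q \<in> ball x s" if "q \<in> closed_segment x (t i)" "i < 3" for q i
    using closed_segment_in_ball[OF that(1) dt(1)[OF that(2)] s(1)] .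
  have segy: "q = u i \<or> q \<in> ball y s" if "q \<in> closed_segment y (u i)" "i < 3" for q i
    using closed_segment_in_ball[OF that(1) dt(2)[OF that(2)] s(1)] .
  have sub_cball: "closed_segment x (t i) \<subseteq> cball x s" "closed_segment y (u i) \<subseteq> cball y s"
    if "i < 3" for i
    using t(2)[OF that] u(2)[OF that] s(1) by (simp_all add: closed_segment_subset)
  have XR: "X i \<inter> R k = {}" if "i < 3" "k < 3" "i \<noteq> k" for i k
    unfolding R_def using segx[OF _ that(2)] segy[OF _ that(2)] t(1)[OF that(2)] u(1)[OF that(2)]
      X_off[OF that(1)] X_disj[OF that] by blast
  have RR: "R i \<inter> R k \<subseteq> {x,y}" if "i < 3" "k < 3" "i \<noteq> k" for i k
  proof
    fix q assume q: "q \<in> R i \<inter> R k"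
    have "t i \<noteq> t k" "u i \<noteq> u k"
      using t(1) u(1) X_disj that by (metis IntI empty_iff)+
    then have "q = x" if "q \<in> closed_segment x (t i)" "q \<in> closed_segment x (t k)"
      using radial_segments_meet_at_center[OF dt(1) dt(1) s(1)] that \<open>i < 3\<close> \<open>k < 3\<close> by blast
    moreover have "q = y" if "q \<in> closed_segment y (u i)" "q \<in> closed_segment y (u k)"
      using radial_segments_meet_at_center[OF dt(2) dt(2) s(1)] that \<open>i < 3\<close> \<open>k < 3\<close> \<open>u i \<noteq> u k\<close> by blast
    ultimately show "q \<in> {x,y}"
      using q s(2) sub_cball that unfolding R_def by blast
  qed
  have Rc: "compact (R k)" for k
    unfolding R_def by (intro compact_Un compact_segment)
  have "\<exists>d>0. \<forall>(i,k)\<in>{(i,k). i < 3 \<and> k < 3 \<and> i \<noteq> k}. \<forall>a\<in>X i. \<forall>b\<in>X k \<union> R k. d \<le> dist a b"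
  proof -
    have "finite {(i,k). i < 3 \<and> k < 3 \<and> i \<noteq> (k::nat)}"
      by (rule finite_subset[of _ "{..<3} \<times> {..<3}"]) auto
    then have "\<exists>d>0. \<forall>p\<in>{(i,k). i < 3 \<and> k < 3 \<and> i \<noteq> k}.
        \<forall>a\<in>X (fst p). \<forall>b\<in>X (snd p) \<union> R (snd p). d \<le> dist a b"
    proof (rule uniform_positive_bound)
      fix p :: "nat \<times> nat" assume "p \<in> {(i,k). i < 3 \<and> k < 3 \<and> i \<noteq> k}"
      then have p: "fst p < 3" "snd p < 3" "fst p \<noteq> snd p" by auto
      show "\<exists>d>0. \<forall>a\<in>X (fst p). \<forall>b\<in>X (snd p) \<union> R (snd p). d \<le> dist a b"
      proof (rule separate_compact_closed)
        show "compact (X (fst p))" "closed (X (snd p) \<union> R (snd p))"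
          using X(1) p Rc by (auto intro: compact_imp_closed)
        show "X (fst p) \<inter> (X (snd p) \<union> R (snd p)) = {}"
          using X_disj[OF p] XR[OF p] by blast
      qed
    qed (meson order_trans)
    then show ?thesis by (auto simp: case_prod_unfold)
  qed
  then obtain d0 where d0: "d0 > 0"
      "\<And>i k a b. i < 3 \<Longrightarrow> k < 3 \<Longrightarrow> i \<noteq> k \<Longrightarrow> a \<in> X i \<Longrightarrow> b \<in> X k \<union> R k \<Longrightarrow> d0 \<le> dist a b"
    by auto
  \<comment> \<open>Half of \<open>d0\<close>: a common point of two \<open>e\<close>-neighbourhoods
    would give points of different continua closer than \<open>d0\<close>.\<close>
  define e where "e = d0 / 2"
  have e: "e > 0" using d0 by (simp add: e_def)
  define V where "V = (\<lambda>d i. \<Union>a\<in>X i. ball a d)"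
  have V_mono: "V d i \<subseteq> V d' i" if "d \<le> d'" for d d' i
    using that unfolding V_def by force
  have VV: "V e i \<inter> V e k = {}" if ik: "i < 3" "k < 3" "i \<noteq> k" for i k
  proof (rule ccontr)
    assume "V e i \<inter> V e k \<noteq> {}"
    then obtain q a b where q: "a \<in> X i" "b \<in> X k" "dist a q < e" "dist b q < e"
      by (auto simp: V_def)
    then have "dist a b < d0"
      unfolding e_def by (metis dist_commute dist_triangle_half_r)
    then show False
      using d0(2)[OF ik q(1), of b] q(2) by auto
  qed
  have VR: "V e i \<inter> R k = {}" if ik: "i < 3" "k < 3" "i \<noteq> k" for i k
  proof (rule ccontr)
    assume "V e i \<inter> R k \<noteq> {}"
    then obtain q a where q: "a \<in> X i" "q \<in> R k" "dist a q < e"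
      by (auto simp: V_def)
    then show False
      using d0(1) d0(2)[OF ik q(1), of q] q(2) by (auto simp: e_def)
  qed
  have "\<forall>i\<in>{..<3}. \<exists>w. w \<in> Y \<and> dist w (z i) < e"
    using z e by (auto simp: closure_approachable)
  then obtain w where w: "\<And>i. i < 3 \<Longrightarrow> w i \<in> Y" "\<And>i. i < 3 \<Longrightarrow> dist (w i) (z i) < e"
    by (metis bchoice lessThan_iff)
  have pcY: "path_connected Y"
    using Y connected_open_path_connected by blast
  \<comment> \<open>Two paths in \<open>Y\<close> through \<open>w 0\<close>, \<open>w 1\<close>,
    \<open>w 2\<close> form the compact connected set \<open>T\<close>. Being compact it has
    positive distance from the continua, whereas the closure of \<open>Y\<close> touches
    them.\<close>
  obtain g0 where g0: "path g0" "path_image g0 \<subseteq> Y" "pathstart g0 = w 0" "pathfinish g0 = w 1"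
    using pcY w(1)[of 0] w(1)[of 1] unfolding path_connected_def by fastforce
  obtain g1 where g1: "path g1" "path_image g1 \<subseteq> Y" "pathstart g1 = w 1" "pathfinish g1 = w 2"
    using pcY w(1)[of 1] w(1)[of 2] unfolding path_connected_def by fastforce
  define T where "T = path_image g0 \<union> path_image g1"
  have wT: "w 0 \<in> T" "w 1 \<in> T" "w 2 \<in> T"
    using g0 g1 unfolding T_def by (metis UnI1 UnI2 pathfinish_in_path_image pathstart_in_path_image)+
  have T: "compact T" "connected T" "T \<subseteq> Y"
  proof -
    have "w 1 \<in> path_image g0 \<inter> path_image g1"
      using g0 g1 by (metis IntI pathfinish_in_path_image pathstart_in_path_image)
    then show "connected T"
      unfolding T_def using g0 g1 by (intro connected_Un) (auto simp: connected_path_image)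
  qed (use g0 g1 in \<open>auto simp: T_def compact_path_image\<close>)
  have "\<exists>d>0. \<forall>i\<in>{..<3}. \<forall>a\<in>X i. \<forall>b\<in>T. d \<le> dist a b"
  proof (rule uniform_positive_bound)
    fix i :: nat assume "i \<in> {..<3}"
    then show "\<exists>d>0. \<forall>a\<in>X i. \<forall>b\<in>T. d \<le> dist a b"
      using X(1) Y_off T(1,3) by (intro separate_compact_closed compact_imp_closed) auto
  qed (simp, meson order_trans)
  then obtain d1 where d1: "d1 > 0" "\<And>i a b. i < 3 \<Longrightarrow> a \<in> X i \<Longrightarrow> b \<in> T \<Longrightarrow> d1 \<le> dist a b"
    by auto
  \<comment> \<open>The arcs will use the thin neighbourhoods \<open>V d i\<close>, which miss
    \<open>T\<close>; the wider sets \<open>V e i\<close> reach \<open>T\<close> and serve as the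
    bridges from the arcs to it.\<close>
  define d where "d = min d1 e"
  have d: "d > 0" "d \<le> e" "d \<le> d1"
    using d1 e by (auto simp: d_def)
  have VT: "V d i \<inter> T = {}" if "i < 3" for i
    using d1(2)[OF that] d(3) unfolding V_def by fastforce
  have RT: "R i \<inter> T = {}" if "i < 3" for i
    using T(3) Y(3) sub_cball[OF that] unfolding R_def by blast
  have XV: "X i \<subseteq> V d i" for i
    using d(1) by (auto simp: V_def)
  define S where "S = (\<lambda>i. V d i \<union> R i)"
  have SS: "S i \<inter> S k \<subseteq> {x,y}" if ik: "i < 3" "k < 3" "i \<noteq> k" for i k
    unfolding S_def using VV[OF ik] VR[OF ik] VR[OF ik(2,1) not_sym[OF ik(3)]] RR[OF ik]
      V_mono[OF d(2)] by blast
  have "x \<noteq> y" using s by auto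
  have "\<exists>c. arc c \<and> path_image c \<subseteq> S i \<and> pathstart c = x \<and> pathfinish c = y" if "i < 3" for i
  proof -
    have "path_connected (V d i)"
      using connected_union_balls[OF X(2)[OF that] d(1)] unfolding V_def
      by (intro connected_open_path_connected open_UN) auto
    moreover have "t i \<in> V d i" "u i \<in> V d i"
      using XV t u that by blast+
    then have "V d i \<inter> closed_segment x (t i) \<noteq> {}"
      "(V d i \<union> closed_segment x (t i)) \<inter> closed_segment y (u i) \<noteq> {}"
      by (meson disjoint_iff ends_in_segment(2) UnI1)+
    ultimately have "path_connected (V d i \<union> closed_segment x (t i) \<union> closed_segment y (u i))"
      by (simp add: path_connected_Un convex_imp_path_connected)
    then have "path_connected (S i)"
      by (simp add: S_def R_def Un_assoc)
    moreover have "x \<in> S i" "y \<in> S i"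
      by (auto simp: S_def R_def)
    ultimately show ?thesis
      using \<open>x \<noteq> y\<close> path_connected_arcwise by blast
  qed
  then obtain c where c: "\<And>i. i < 3 \<Longrightarrow> arc (c i)" "\<And>i. i < 3 \<Longrightarrow> path_image (c i) \<subseteq> S i"
      "\<And>i. i < 3 \<Longrightarrow> pathstart (c i) = x" "\<And>i. i < 3 \<Longrightarrow> pathfinish (c i) = y"
    by metis
  have cc: "path_image (c i) \<inter> path_image (c k) = {x,y}" if ik: "i < 3" "k < 3" "i \<noteq> k" for i k
  proof
    show "path_image (c i) \<inter> path_image (c k) \<subseteq> {x,y}"
      using SS[OF ik] c(2)[OF ik(1)] c(2)[OF ik(2)] by blast
    show "{x,y} \<subseteq> path_image (c i) \<inter> path_image (c k)"
      using c(3,4) ik by (metis Int_iff insert_iff pathfinish_in_path_image pathstart_in_path_image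
          singletonD subsetI)
  qed
  have Tc: "T \<inter> path_image (c i) = {}" if "i < 3" for i
    using VT[OF that] RT[OF that] c(2)[OF that] unfolding S_def by blast
  have Vc: "V e i \<inter> path_image (c k) = {}" if ik: "i < 3" "k < 3" "i \<noteq> k" for i k
    using VV[OF ik] VR[OF ik] V_mono[OF d(2)] c(2)[OF ik(2)] unfolding S_def by blast
  \<comment> \<open>Otherwise the arc from \<open>x\<close> to \<open>y\<close> would lie in two
    disjoint closed segments, one containing \<open>x\<close> and the other
    \<open>y\<close>.\<close>
  have Vci: "V e i \<inter> path_image (c i) \<noteq> {}" if i: "i < 3" for i
  proof
    assume "V e i \<inter> path_image (c i) = {}"
    then have sub: "path_image (c i) \<subseteq> closed_segment x (t i) \<union> closed_segment y (u i)"
      using V_mono[OF d(2)] c(2)[OF i] unfolding S_def R_def by blast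
    have "closed_segment x (t i) \<inter> closed_segment y (u i) = {}"
      using sub_cball[OF i] s(2) by blast
    moreover have "x \<in> path_image (c i)" "y \<in> path_image (c i)"
      using c(3,4)[OF i] by (metis pathstart_in_path_image, metis pathfinish_in_path_image)
    moreover have "connected (path_image (c i))"
      using c(1)[OF i] connected_arc_image by blast
    ultimately show False
      using connected_closedD[of "path_image (c i)" "closed_segment x (t i)" "closed_segment y (u i)"] sub
      by (metis (no_types, lifting) closed_segment disjoint_iff ends_in_segment(1) inf_bot_left)
  qed
  have Ve: "connected (V e i)" "V e i \<inter> T \<noteq> {}" if i: "i < 3" for i
  proof -
    show "connected (V e i)"
      unfolding V_def using connected_union_balls X(2)[OF i] e by blast
    have "i = 0 \<or> i = 1 \<or> i = 2" using i by auto
    then have "w i \<in> T" using wT by auto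
    moreover have "w i \<in> V e i"
      using z[OF i] w(2)[OF i] unfolding V_def by (auto simp: dist_commute intro!: bexI[of _ "z i"])
    ultimately show "V e i \<inter> T \<noteq> {}" by blast
  qed
  have lt: "0 < (3::nat)" "1 < (3::nat)" "2 < (3::nat)" and ne: "0 \<noteq> (1::nat)" "0 \<noteq> (2::nat)" "1 \<noteq> (2::nat)"
    "1 \<noteq> (0::nat)" "2 \<noteq> (0::nat)" "2 \<noteq> (1::nat)"
    by auto
  show False
  proof (rule arcs_no_theta_face[of "c 0" "c 1" "c 2" x y T "V e 0" "V e 1" "V e 2"])
    show "T \<noteq> {}" using wT by blast
    show "T \<inter> (path_image (c 0) \<union> path_image (c 1) \<union> path_image (c 2)) = {}"
      using Tc[OF lt(1)] Tc[OF lt(2)] Tc[OF lt(3)] by blast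
    show "V e 0 \<inter> (path_image (c 1) \<union> path_image (c 2)) = {}"
      using Vc[OF lt(1,2) ne(1)] Vc[OF lt(1,3) ne(2)] by blast
    show "V e 1 \<inter> (path_image (c 0) \<union> path_image (c 2)) = {}"
      using Vc[OF lt(2,1) ne(4)] Vc[OF lt(2,3) ne(3)] by blast
    show "V e 2 \<inter> (path_image (c 0) \<union> path_image (c 1)) = {}"
      using Vc[OF lt(3,1) ne(5)] Vc[OF lt(3,2) ne(6)] by blast
  qed (use c lt cc ne T Ve Vci in simp_all)
qed

section \<open>The planar crossing theorem\<close>

text \<open>\<open>A\<close> stands for the closed annulus with one of its interior points sent to
  infinity. In that picture the sides of the two curves away from the annulus are both bounded,
  which is what the hypotheses on \<open>inside\<close> express. \<open>Px\<close> and
  \<open>Py\<close> translate the membership of \<open>x\<close> and \<open>y\<close> in the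
  Hausdorff limit.\<close>

lemma infinitely_many_crossing_components:
  fixes K A D E :: "complex set" and g1 g2 :: "real \<Rightarrow> complex" and P :: "nat \<Rightarrow> complex set"
  assumes K: "compact K" and A: "closed A"
    and g1: "simple_path g1" "pathfinish g1 = pathstart g1"
    and g2: "simple_path g2" "pathfinish g2 = pathstart g2"
    and fr: "frontier A \<subseteq> path_image g1 \<union> path_image g2"
    and ins: "A \<inter> inside (path_image g1) = {}" "A \<inter> inside (path_image g2) = {}"
    and DE: "open D" "open E" "closure D \<inter> closure E = {}" "x \<in> D" "y \<in> E"
    and P: "inj P" "\<And>n. P n \<in> components (K \<inter> A)"
    and Px: "\<And>G. open G \<Longrightarrow> x \<in> G \<Longrightarrow> eventually (\<lambda>n. P n \<inter> G \<noteq> {}) sequentially"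
    and Py: "\<And>G. open G \<Longrightarrow> y \<in> G \<Longrightarrow> eventually (\<lambda>n. P n \<inter> G \<noteq> {}) sequentially"
  shows "infinite {C \<in> components (K - (D \<union> E)). C \<inter> closure D \<noteq> {} \<and> C \<inter> closure E \<noteq> {}}"
    (is "infinite ?CC")
proof
  assume "finite ?CC"
  define CC where "CC = ?CC"
  have fin: "finite CC"
    using \<open>finite ?CC\<close> by (simp add: CC_def)
  \<comment> \<open>Two scales are in play: components are counted with respect to \<open>D\<close>
    and \<open>E\<close>, while the smaller discs of radius \<open>s\<close> are the first two sets
    touched in the nonplanarity argument.\<close>
  obtain s where s: "s > 0" "cball x s \<subseteq> D" "cball y s \<subseteq> E"
  proof -
    obtain s1 s2 where "s1 > 0" "cball x s1 \<subseteq> D" "s2 > 0" "cball y s2 \<subseteq> E"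
      using DE open_contains_cball by metis
    then show thesis
      by (intro that[of "min s1 s2"]) auto
  qed
  have cb_disj: "cball x s \<inter> cball y s = {}"
    using s DE(3) closure_subset[of D] closure_subset[of E] by blast
  have cKA: "compact (K \<inter> A)"
    using K A by blast
  have Pc: "compact (P n)" "connected (P n)" "P n \<subseteq> K" "P n \<subseteq> A" for n
    using P(2)[of n] cKA compact_components in_components_connected in_components_subset by blast+
  have P_disj: "P n \<inter> P m = {}" if "n \<noteq> m" for n m
    using components_nonoverlap[OF P(2) P(2)] P(1) that by (metis injD)
  have "eventually (\<lambda>n. P n \<inter> ball x s \<noteq> {} \<and> P n \<inter> ball y s \<noteq> {}) sequentially"
    using Px[of "ball x s"] Py[of "ball y s"] s(1) by (auto intro: eventually_conj)
  then obtain N0 where N0: "\<And>n. n \<ge> N0 \<Longrightarrow> P n \<inter> ball x s \<noteq> {}" "\<And>n. n \<ge> N0 \<Longrightarrow> P n \<inter> ball y s \<noteq> {}"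
    unfolding eventually_sequentially by blast
  have cl_ball: "closure (ball x s) = cball x s" "closure (ball y s) = cball y s"
    using s(1) by auto
  \<comment> \<open>\<open>Q'\<close> is a part of \<open>P n\<close> crossing between the small
    discs, \<open>Q\<close> will be a part of \<open>Q'\<close> crossing between \<open>D\<close>
    and \<open>E\<close>, and \<open>C\<close> is the counted component containing
    \<open>Q\<close>.\<close>
  define G where "G = (\<lambda>n Q' Q C. Q' \<in> components (P n - (ball x s \<union> ball y s)) \<and> Q' \<inter> cball x s \<noteq> {}
      \<and> Q' \<inter> cball y s \<noteq> {} \<and> connected Q \<and> Q \<noteq> {} \<and> Q \<subseteq> Q' \<and> Q \<subseteq> C \<and> C \<in> CC)"
  have "\<exists>Q' Q C. G n Q' Q C" if n: "n \<ge> N0" for n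
  proof -
    obtain Q' where Q': "Q' \<in> components (P n - (ball x s \<union> ball y s))" "Q' \<inter> cball x s \<noteq> {}" "Q' \<inter> cball y s \<noteq> {}"
      using continuum_crossing_component[OF Pc(1,2)[of n], of "ball x s" "ball y s"] N0[OF n] cb_disj
      unfolding cl_ball by auto
    have Q'c: "connected Q'" "Q' \<subseteq> P n"
      using Q'(1) in_components_connected in_components_subset by blast+
    have "compact (P n - (ball x s \<union> ball y s))"
      using Pc(1) by (intro compact_diff) auto
    then have Q'k: "compact Q'"
      using Q'(1) compact_components by blast
    have "Q' \<inter> D \<noteq> {}" "Q' \<inter> E \<noteq> {}"
      using Q'(2,3) s by blast+
    then obtain Q where Q: "Q \<in> components (Q' - (D \<union> E))" "Q \<inter> closure D \<noteq> {}" "Q \<inter> closure E \<noteq> {}"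
      using continuum_crossing_component[OF Q'k Q'c(1) DE(1-3)] by blast
    have Qc: "connected Q" "Q \<subseteq> Q' - (D \<union> E)" "Q \<noteq> {}"
      using Q(1) in_components_connected in_components_subset in_components_nonempty by blast+
    have "Q \<subseteq> K - (D \<union> E)"
      using Qc(2) Q'c(2) Pc(3) by blast
    then obtain C where C: "C \<in> components (K - (D \<union> E))" "Q \<subseteq> C"
      using exists_component_superset[of Q] Qc by (metis subset_empty)
    then have "C \<in> CC"
      unfolding CC_def using Q(2,3) by blast
    then show ?thesis
      unfolding G_def using Q' Qc C(2) by (intro exI[of _ Q'] exI[of _ Q] exI[of _ C] conjI) auto
  qed
  then obtain Q' Q C where G: "\<And>n. n \<ge> N0 \<Longrightarrow> G n (Q' n) (Q n) (C n)"
    by metis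
  have Q': "Q' n \<in> components (P n - (ball x s \<union> ball y s))" "Q' n \<inter> cball x s \<noteq> {}" "Q' n \<inter> cball y s \<noteq> {}"
    and Q: "connected (Q n)" "Q n \<noteq> {}" "Q n \<subseteq> Q' n" "Q n \<subseteq> C n"
    and C: "C n \<in> CC" if "n \<ge> N0" for n
    using G[OF that] by (simp_all add: G_def)
  \<comment> \<open>Infinitely many indices share finitely many counted components, so one component
    \<open>C0\<close> serves an infinite index set \<open>I\<close>.\<close>
  have "C ` {N0..} \<subseteq> CC"
    using C by auto
  then have "finite (C ` {N0..})"
    using fin by (rule finite_subset)
  then obtain a where a: "a \<in> {N0..}" "infinite {n \<in> {N0..}. C n = C a}"
    using pigeonhole_infinite[OF infinite_Ici, of C N0] by blast
  define C0 where "C0 = C a"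
  define I where "I = {n \<in> {N0..}. C n = C0}"
  have I: "infinite I" "\<And>n. n \<in> I \<Longrightarrow> n \<ge> N0" "\<And>n. n \<in> I \<Longrightarrow> C n = C0"
    using a(2) by (auto simp: I_def C0_def)
  obtain n0 where n0: "n0 \<in> I"
    using infinite_imp_nonempty[OF I(1)] by blast
  have "infinite (I - {n0})"
    using I(1) by simp
  then obtain n1 where n1: "n1 \<in> I" "n1 \<noteq> n0"
    using infinite_imp_nonempty[of "I - {n0}"] by blast
  have C0: "C0 \<in> components (K - (D \<union> E))"
    using C[OF I(2)[OF n0]] I(3)[OF n0] by (simp add: CC_def)
  have C0c: "connected C0" "C0 \<subseteq> K - (D \<union> E)" "compact C0"
    using C0 in_components_connected in_components_subset compact_components[OF _ C0]
      compact_diff[OF K open_Un[OF DE(1,2)]] by blast+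
  have QP: "Q' n \<subseteq> P n - (ball x s \<union> ball y s)" "Q n \<subseteq> P n" "Q n \<subseteq> C0 \<inter> A" if "n \<in> I" for n
  proof -
    note n = I(2)[OF that]
    show a: "Q' n \<subseteq> P n - (ball x s \<union> ball y s)"
      using Q'(1)[OF n] in_components_subset by blast
    then show b: "Q n \<subseteq> P n" using Q(3)[OF n] by blast
    then show "Q n \<subseteq> C0 \<inter> A" using Q(4)[OF n] I(3)[OF that] Pc(4) by blast
  qed
  \<comment> \<open>Each \<open>P n\<close> with \<open>n\<close> in \<open>I\<close> shares
    \<open>Q n\<close> with \<open>C0\<close>. If \<open>C0\<close> stayed in \<open>A\<close>,
    maximality would place it in all these disjoint components at once.\<close>
  have notA: "\<not> C0 \<subseteq> A"
  proof
    assume "C0 \<subseteq> A"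
    then have "C0 \<subseteq> K \<inter> A" using C0c by blast
    then have "C0 \<subseteq> P n" if "n \<in> I" for n
      using components_maximal[OF P(2) C0c(1), of n] QP(2,3)[OF that] Q(2)[OF I(2)[OF that]] by blast
    then have "C0 \<subseteq> P n0 \<inter> P n1" using n0 n1 by blast
    then show False
      using P_disj[OF n1(2)] C0 in_components_nonempty by blast
  qed
  \<comment> \<open>\<open>C'\<close> is the component of \<open>C0 \<inter> A\<close> around
    \<open>Q n\<close>. It stays in \<open>P n\<close> by maximality and reaches the frontier of
    \<open>A\<close> at \<open>p\<close> by boundary bumping.\<close>
  define F where "F = (\<lambda>n C' p. C' \<in> components (C0 \<inter> A) \<and> Q n \<subseteq> C' \<and> C' \<subseteq> P n \<and> p \<in> C' \<and> p \<in> frontier A)"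
  have "\<exists>C' p. F n C' p" if n: "n \<in> I" for n
  proof -
    obtain C' where C': "C' \<in> components (C0 \<inter> A)" "Q n \<subseteq> C'"
      using exists_component_superset[OF QP(3)[OF n] _ Q(1)[OF I(2)[OF n]]] QP(3)[OF n]
        Q(2)[OF I(2)[OF n]] by blast
    have "connected C'" "C' \<subseteq> K \<inter> A"
      using C'(1) C0c(2) in_components_connected in_components_subset by blast+
    then have "C' \<subseteq> P n"
      using components_maximal[OF P(2), of C' n] QP(2)[OF n] C'(2) Q(2)[OF I(2)[OF n]] by blast
    moreover obtain p where "p \<in> C'" "p \<in> frontier A"
      using component_meets_frontier[OF C0c(3,1) A notA C'(1)] by blast
    ultimately show ?thesis unfolding F_def using C' by blast
  qed
  then obtain C' p where F: "\<And>n. n \<in> I \<Longrightarrow> F n (C' n) (p n)"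
    by metis
  have C': "C' n \<in> components (C0 \<inter> A)" "Q n \<subseteq> C' n" "C' n \<subseteq> P n"
    and p: "p n \<in> C' n" "p n \<in> frontier A" if "n \<in> I" for n
    using F[OF that] by (simp_all add: F_def)
  \<comment> \<open>\<open>Q' n\<close> reaches the two small discs, \<open>C' n\<close> reaches the
    frontier of \<open>A\<close>, and their common part \<open>Q n\<close> holds them
    together.\<close>
  define X where "X = (\<lambda>n. Q' n \<union> C' n)"
  have X: "compact (X n)" "connected (X n)" "X n \<subseteq> P n" "X n \<inter> ball x s = {}" "X n \<inter> ball y s = {}"
      "X n \<inter> cball x s \<noteq> {}" "X n \<inter> cball y s \<noteq> {}" "p n \<in> X n" "p n \<notin> D" "p n \<notin> E"
    if n: "n \<in> I" for n
  proof -
    note n' = I(2)[OF n]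
    have "compact (Q' n)"
      using compact_components[OF _ Q'(1)[OF n']] Pc(1)[of n] by (simp add: compact_diff open_Un)
    moreover have "compact (C' n)"
      using compact_components[OF _ C'(1)[OF n]] C0c(3) A by blast
    ultimately show "compact (X n)"
      unfolding X_def by (rule compact_Un)
    have "Q' n \<inter> C' n \<noteq> {}"
      using C'(2)[OF n] Q(2,3)[OF n'] by blast
    then show "connected (X n)"
      unfolding X_def using C'(1)[OF n] Q'(1)[OF n'] in_components_connected
      by (intro connected_Un) blast+
    show "X n \<subseteq> P n"
      unfolding X_def using QP(1)[OF n] C'(3)[OF n] by blast
    have C'sub: "C' n \<subseteq> C0"
      using C'(1)[OF n] in_components_subset by blast
    show "p n \<in> X n" "p n \<notin> D" "p n \<notin> E"
      using p(1)[OF n] C'sub C0c(2) unfolding X_def by blast+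
    have "ball x s \<subseteq> D" "ball y s \<subseteq> E"
      using s ball_subset_cball by blast+
    then show "X n \<inter> ball x s = {}" "X n \<inter> ball y s = {}"
      unfolding X_def using C'sub C0c(2) QP(1)[OF n] by blast+
    show "X n \<inter> cball x s \<noteq> {}" "X n \<inter> cball y s \<noteq> {}"
      unfolding X_def using Q'(2,3)[OF n'] by blast+
  qed
  have X_disj: "X n \<inter> X m = {}" if "n \<in> I" "m \<in> I" "n \<noteq> m" for n m
    using X(3)[OF that(1)] X(3)[OF that(2)] P_disj[OF that(3)] by blast
  \<comment> \<open>Proved for an arbitrary curve, since it is not known which of the two receives
    infinitely many of the points \<open>p n\<close>.\<close>
  have one_curve: "False"
    if g: "simple_path g" "pathfinish g = pathstart g" "A \<inter> inside (path_image g) = {}"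
      and I': "infinite I'" "I' \<subseteq> I" "\<And>n. n \<in> I' \<Longrightarrow> p n \<in> path_image g"
    for g :: "real \<Rightarrow> complex" and I'
  proof -
    define e where "e = enumerate I'"
    have e: "e n \<in> I'" "inj e" for n
      using I'(1) enumerate_in_set strict_mono_enumerate strict_mono_imp_inj_on
      unfolding e_def by blast+
    \<comment> \<open>The points \<open>p n\<close> lie outside the open sets \<open>D\<close> and
      \<open>E\<close>; so does their accumulation point \<open>q\<close>, which therefore keeps
      away from the closed small discs.\<close>
    define J where "J = path_image g - (D \<union> E)"
    have "compact J"
      unfolding J_def using g(1) DE(1,2) by (intro compact_diff compact_simple_path_image open_Un)
    moreover have "\<forall>n. p (e n) \<in> J"
      using e(1) I'(2,3) X(9,10) unfolding J_def by blast
    ultimately obtain q r where q: "q \<in> J" "strict_mono (r::nat\<Rightarrow>nat)" "((\<lambda>n. p (e n)) \<circ> r) \<longlonglongrightarrow> q"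
      unfolding compact_def by meson
    define N where "N = - (cball x s \<union> cball y s)"
    have "open N" "q \<in> N"
      unfolding N_def using q(1) s(2,3) by (auto simp: J_def intro!: open_Compl closed_Un)
    moreover have "q \<in> path_image g" using q(1) by (simp add: J_def)
    \<comment> \<open>\<open>Y\<close> is the third set touched. It lies inside the curve, where
      \<open>A\<close> and hence every \<open>X n\<close> is absent, and its closure contains the
      curve near \<open>q\<close>.\<close>
    ultimately obtain Y N' where Y: "open Y" "connected Y" "Y \<subseteq> N \<inter> inside (path_image g)"
      "open N'" "q \<in> N'" "N' \<subseteq> N" "path_image g \<inter> N' \<subseteq> closure Y"
      using Jordan_inside_locally_connected[OF g(1,2)] by metis
    obtain m where m: "\<And>n. n \<ge> m \<Longrightarrow> p (e (r n)) \<in> N'"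
      using topological_tendstoD[OF q(3) Y(4,5)] by (auto simp: eventually_sequentially)
    \<comment> \<open>Starting the subsequence at \<open>m\<close> puts every \<open>p (f i)\<close>
      into \<open>N'\<close>; the indices \<open>0\<close>, \<open>1\<close>, \<open>2\<close>
      provide the three continua.\<close>
    define f where "f = (\<lambda>i. e (r (m + i)))"
    have f: "f i \<in> I" "p (f i) \<in> N'" "p (f i) \<in> path_image g" for i
      using e(1) I'(2,3) m unfolding f_def by auto
    have f_inj: "f i \<noteq> f j" if "i \<noteq> j" for i j
      using that e(2) q(2) unfolding f_def by (metis add_left_cancel injD strict_mono_eq)
    have XA: "X (f i) \<subseteq> A" for i
      using X(3)[OF f(1)] Pc(4) by blast
    show False
    proof (rule no_three_continua_touching_three_sets[of "\<lambda>i. X (f i)" s x y Y])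
      fix i :: nat
      show "X (f i) \<inter> Y = {}"
        using XA[of i] Y(3) g(3) by blast
      have "p (f i) \<in> X (f i) \<inter> closure Y"
        using X(8)[OF f(1)] f(2,3)[of i] Y(7) by blast
      moreover have "p (f i) \<notin> cball x s \<union> cball y s"
        using f(2)[of i] Y(6) unfolding N_def by blast
      ultimately show "X (f i) \<inter> closure Y - (cball x s \<union> cball y s) \<noteq> {}"
        by blast
    next
      show "Y \<inter> (cball x s \<union> cball y s) = {}"
        using Y(3) unfolding N_def by blast
    next
      fix i j :: nat assume "i \<noteq> j"
      then show "X (f i) \<inter> X (f j) = {}"
        using X_disj[OF f(1) f(1) f_inj] by blast
    qed (use X[OF f(1)] s(1) cb_disj Y(1,2) in auto)
  qed
  define I1 where "I1 = {n \<in> I. p n \<in> path_image g1}"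
  define I2 where "I2 = {n \<in> I. p n \<in> path_image g2}"
  have "I \<subseteq> I1 \<union> I2"
    using p(2) fr unfolding I1_def I2_def by blast
  then have "infinite I1 \<or> infinite I2"
    using I(1) finite_subset by blast
  then show False
  proof
    assume "infinite I1"
    then show False
      using one_curve[OF g1 ins(1)] unfolding I1_def by blast
  next
    assume "infinite I2"
    then show False
      using one_curve[OF g2 ins(2)] unfolding I2_def by blast
  qed
qed

section \<open>Spherical distance and stereographic projection\<close>

lemma inner_le_one_S2:
  assumes "a \<in> S2" "b \<in> S2"
  shows "-1 \<le> a \<bullet> b" "a \<bullet> b \<le> 1" "\<bar>a \<bullet> b\<bar> \<le> 1"
  using Cauchy_Schwarz_ineq2[of a b] assms by auto

lemma cos_rho: "a \<in> S2 \<Longrightarrow> b \<in> S2 \<Longrightarrow> cos (rho a b) = a \<bullet> b"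
  unfolding rho_def using inner_le_one_S2 by (simp add: cos_arccos)

lemma rho_bounds: "a \<in> S2 \<Longrightarrow> b \<in> S2 \<Longrightarrow> 0 \<le> rho a b \<and> rho a b \<le> pi"
  unfolding rho_def using inner_le_one_S2 by (simp add: arccos_lbound arccos_ubound)

lemma rho_commute: "rho a b = rho b a"
  by (simp add: rho_def inner_commute)

lemma continuous_on_rho:
  assumes "x \<in> S2"
  shows "continuous_on S2 (rho x)"
proof -
  have "continuous_on S2 (\<lambda>w. arccos (x \<bullet> w))"
  proof (rule continuous_on_arccos)
    show "continuous_on S2 ((\<bullet>) x)"
      by (intro continuous_intros)
    show "\<forall>w\<in>S2. - 1 \<le> x \<bullet> w \<and> x \<bullet> w \<le> 1"
      using inner_le_one_S2[OF assms] by blast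
  qed
  then show ?thesis
    unfolding rho_def .
qed

text \<open>The parts \<open>p\<close> and \<open>q\<close> of \<open>a\<close> and \<open>b\<close>
  orthogonal to \<open>w\<close> have norms \<open>sin (rho a w)\<close> and
  \<open>sin (rho w b)\<close>. Cauchy-Schwarz and the addition formula bound
  \<open>cos (rho a w + rho w b)\<close> by \<open>a \<bullet> b\<close>, and the cosine decreases
  up to \<open>pi\<close>. Beyond \<open>pi\<close> the claim follows from
  \<open>rho_bounds\<close>.\<close>

lemma rho_triangle:
  assumes "a \<in> S2" "b \<in> S2" "w \<in> S2"
  shows "rho a b \<le> rho a w + rho w b"
proof (cases "rho a w + rho w b \<le> pi")
  case True
  define p q where "p = a - (a \<bullet> w) *\<^sub>R w" and "q = b - (b \<bullet> w) *\<^sub>R w"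
  have n: "a \<bullet> a = 1" "b \<bullet> b = 1" "w \<bullet> w = 1"
    using assms by (auto simp: norm_eq_1)
  have "p \<bullet> p = 1 - (a \<bullet> w)\<^sup>2" "q \<bullet> q = 1 - (b \<bullet> w)\<^sup>2"
    by (simp_all add: p_def q_def inner_diff_left inner_diff_right n inner_commute power2_eq_square)
  moreover have "sin (rho a w) = sqrt (1 - (a \<bullet> w)\<^sup>2)"
    using sin_cos_sqrt[of "rho a w"] sin_ge_zero[of "rho a w"] rho_bounds[OF assms(1,3)]
      cos_rho[OF assms(1,3)] by simp
  moreover have "sin (rho w b) = sqrt (1 - (b \<bullet> w)\<^sup>2)"
    using sin_cos_sqrt[of "rho w b"] sin_ge_zero[of "rho w b"] rho_bounds[OF assms(3,2)]
      cos_rho[OF assms(3,2)] by (simp add: inner_commute)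
  ultimately have "norm p = sin (rho a w)" "norm q = sin (rho w b)"
    by (simp_all add: norm_eq_sqrt_inner)
  moreover have "p \<bullet> q = a \<bullet> b - (a \<bullet> w) * (b \<bullet> w)"
    by (simp add: p_def q_def inner_diff_left inner_diff_right n inner_commute)
  moreover have "- (norm p * norm q) \<le> p \<bullet> q"
    using Cauchy_Schwarz_ineq2[of p q] by linarith
  ultimately have "cos (rho a w + rho w b) \<le> a \<bullet> b"
    using assms by (simp add: cos_add cos_rho inner_commute)
  then have "cos (rho a w + rho w b) \<le> cos (rho a b)"
    using assms by (simp add: cos_rho)
  then show ?thesis
    using True assms rho_bounds by (subst (asm) cos_mono_le_eq) (auto simp: add_nonneg_nonneg)
next
  case False
  then show ?thesis
    using rho_bounds[OF assms(1,2)] by linarith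
qed

text \<open>The chord of an angle \<open>rho a b\<close> has length
  \<open>2 * sin (rho a b / 2)\<close>.\<close>

lemma dist_le_rho:
  assumes "a \<in> S2" "b \<in> S2"
  shows "dist a b \<le> rho a b"
proof -
  have "a \<bullet> a = 1" "b \<bullet> b = 1"
    using assms by (auto simp: norm_eq_1)
  moreover have "(dist a b)\<^sup>2 = a \<bullet> a - 2 * (a \<bullet> b) + b \<bullet> b"
    unfolding dist_norm power2_norm_eq_inner by (simp add: inner_diff_left inner_diff_right inner_commute)
  ultimately have "(dist a b)\<^sup>2 = 2 - 2 * (a \<bullet> b)"
    by linarith
  also have "\<dots> = 2 - 2 * cos (2 * (rho a b / 2))"
    using assms by (simp add: cos_rho)
  also have "\<dots> = (2 * sin (rho a b / 2))\<^sup>2"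
    unfolding cos_double_sin by (simp add: power_mult_distrib)
  also have "\<dots> \<le> (rho a b)\<^sup>2"
  proof (rule power_mono)
    show "2 * sin (rho a b / 2) \<le> rho a b"
      using sin_x_le_x[of "rho a b / 2"] rho_bounds[OF assms] by auto
    show "0 \<le> 2 * sin (rho a b / 2)"
      using rho_bounds[OF assms] by (simp add: sin_ge_zero)
  qed
  finally show ?thesis
    using rho_bounds[OF assms] by (auto intro: power2_le_imp_le)
qed

lemma openin_Dball:
  assumes "x \<in> S2"
  shows "openin (top_of_set S2) (Dball r x)"
proof -
  have "Dball r x = S2 \<inter> rho x -` {..<r}"
    by (auto simp: Dball_def)
  then show ?thesis
    using continuous_openin_preimage_gen[OF continuous_on_rho[OF assms] open_lessThan] by metis
qed

lemma closed_rho_le: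
  assumes "x \<in> S2"
  shows "closed {w \<in> S2. rho x w \<le> r}"
proof -
  have "{w \<in> S2. rho x w \<le> r} = S2 \<inter> rho x -` {..r}"
    by auto
  then show ?thesis
    using continuous_closed_preimage[OF continuous_on_rho[OF assms] closed_sphere closed_atMost] by metis
qed

lemma sbd_eq:
  assumes "openin (top_of_set S2) V"
  shows "sbd V = S2 \<inter> closure V - V"
proof -
  have "S2 \<inter> V = V"
    using openin_imp_subset[OF assms] by blast
  then show ?thesis
    unfolding sbd_def frontier_of_openin[OF assms] closure_of_subtopology by simp
qed

section \<open>Transport between the punctured sphere and the plane\<close>

lemma homeomorphism_image_components:
  fixes M :: "'a::real_normed_vector set" and N :: "'b::real_normed_vector set"
  assumes "homeomorphism M N h k" "C \<in> components M"
  shows "h ` C \<in> components N"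
proof -
  have hk: "k (h a) = a" "h a \<in> N" if "a \<in> M" for a
    using assms(1) that unfolding homeomorphism_def by blast+
  have kh: "h (k b) = b" "k b \<in> M" if "b \<in> N" for b
    using assms(1) that unfolding homeomorphism_def by blast+
  have cont: "continuous_on M h" "continuous_on N k"
    using assms(1) unfolding homeomorphism_def by blast+
  have C: "C \<noteq> {}" "C \<subseteq> M" "connected C"
    using assms(2) in_components_nonempty in_components_subset in_components_connected by blast+
  \<comment> \<open>A larger connected set \<open>D\<close> is pulled back by \<open>k\<close>,
    where the maximality of \<open>C\<close> applies.\<close>
  have "D = h ` C" if D: "h ` C \<subseteq> D" "D \<subseteq> N" "connected D" for D
  proof -
    have "connected (k ` D)"
      using D(2,3) cont(2) by (meson connected_continuous_image continuous_on_subset)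
    moreover have "C \<subseteq> k ` D"
    proof
      fix c assume c: "c \<in> C"
      then have "h c \<in> D" "k (h c) = c" using D(1) C(2) hk by blast+
      then show "c \<in> k ` D" by (metis imageI)
    qed
    moreover have "k ` D \<subseteq> M"
      using D(2) kh(2) by blast
    ultimately have "k ` D \<subseteq> C"
      using components_maximal[OF assms(2), of "k ` D"] C(1) by blast
    then have "h ` k ` D \<subseteq> h ` C" by (rule image_mono)
    moreover have "h ` k ` D = D"
      using D(2) kh(1) by (simp add: image_image subset_iff cong: image_cong)
    ultimately show ?thesis using D(1) by blast
  qed
  moreover have "connected (h ` C)"
    using C(2,3) cont(1) by (meson connected_continuous_image continuous_on_subset)
  moreover have "h ` C \<subseteq> N"
    using C(2) hk(2) by blast
  ultimately show ?thesis
    using C(1) unfolding in_components_maximal by blast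
qed

lemma punctured_S2_homeomorphism:
  assumes "q \<in> S2"
  obtains h :: "real^3 \<Rightarrow> complex" and k where "homeomorphism (S2 - {q}) UNIV h k"
proof -
  have "(S2 - {q}) homeomorphic (UNIV :: complex set)"
    using assms by (intro homeomorphic_punctured_sphere_affine) auto
  then show thesis
    using that by (auto simp: homeomorphic_def)
qed

lemma punctured_S2_open_image:
  assumes h: "homeomorphism (S2 - {q}) (UNIV :: complex set) h k" and V: "openin (top_of_set S2) V"
  shows "open (h ` (V - {q}))"
proof -
  have "openin (top_of_set (S2 - {q})) (V - {q})"
    using V by (auto simp: openin_open)
  then have "openin (top_of_set UNIV) (h ` (V - {q}))"
    using homeomorphism_imp_open_map[OF h] by blast
  then show ?thesis by simp
qed

lemma punctured_S2_closed_image: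
  assumes h: "homeomorphism (S2 - {q}) (UNIV :: complex set) h k" and V: "closed V" "V \<subseteq> S2"
  shows "closed (h ` (V - {q}))"
proof -
  have "closedin (top_of_set (S2 - {q})) (V - {q})"
    using V by (auto simp: closedin_closed)
  then have "closedin (top_of_set UNIV) (h ` (V - {q}))"
    using homeomorphism_imp_closed_map[OF h] by blast
  then show ?thesis by simp
qed

lemma punctured_S2_open_preimage:
  assumes h: "homeomorphism (S2 - {q}) (UNIV :: complex set) h k" and G: "open G"
  obtains T where "open T" "k ` G = S2 \<inter> T"
proof -
  have "openin (top_of_set (S2 - {q})) (k ` G)"
    using homeomorphism_imp_open_map[OF homeomorphism_symD[OF h], of G] G by simp
  moreover have "openin (top_of_set S2) (S2 - {q})"
    by (simp add: openin_delete)
  ultimately show thesis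
    using that by (metis openin_open openin_trans)
qed

text \<open>The puncture \<open>q\<close> becomes the point at infinity. The bounded domain of the
  image curve pulls back to a set that is open in the sphere and becomes closed on adding the curve.
  A connected \<open>U\<close> through \<open>q\<close> that avoids the curve therefore misses this
  set, and so does the closure of \<open>U\<close>.\<close>

lemma punctured_S2_inside_disjoint:
  assumes h: "homeomorphism (S2 - {q}) (UNIV :: complex set) h k"
    and g: "simple_path g" "pathfinish g = pathstart g" "path_image g \<subseteq> S2 - {q}"
    and U: "connected U" "U \<subseteq> S2" "q \<in> U" "U \<inter> path_image g = {}"
    and A: "A \<subseteq> S2" "A \<subseteq> closure U"
  shows "h ` (A - {q}) \<inter> inside (path_image (h \<circ> g)) = {}"
proof -
  define J where "J = path_image g"
  define I where "I = inside (h ` J)"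
  have hk: "\<And>a. a \<in> S2 - {q} \<Longrightarrow> k (h a) = a" "\<And>b. h (k b) = b" "\<And>b. k b \<in> S2 - {q}"
    using h unfolding homeomorphism_def by (blast, simp, blast)
  have sp: "simple_path (h \<circ> g)" "pathfinish (h \<circ> g) = pathstart (h \<circ> g)"
  proof -
    show "simple_path (h \<circ> g)"
    proof (rule simple_path_continuous_image[OF g(1)])
      show "continuous_on (path_image g) h"
        using h g(3) by (meson continuous_on_subset homeomorphism_def)
      show "inj_on h (path_image g)"
        using hk(1) g(3) by (metis inj_on_inverseI subsetD)
    qed
    show "pathfinish (h \<circ> g) = pathstart (h \<circ> g)"
      using g(2) by (simp add: pathfinish_def pathstart_def)
  qed
  have im: "path_image (h \<circ> g) = h ` J"
    by (simp add: J_def path_image_compose)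
  note JI = Jordan_inside_outside[OF sp, unfolded im, folded I_def]
  have "open I" "compact (I \<union> h ` J)"
  proof -
    show "open I" using JI by blast
    have "I \<union> h ` J = closure I"
      using JI by (metis closure_Un_frontier)
    then show "compact (I \<union> h ` J)"
      using JI by (simp add: compact_closure)
  qed
  have "k ` (I \<union> h ` J) = k ` I \<union> J"
  proof -
    have "k ` h ` J = J"
      using hk(1) g(3) unfolding J_def image_image by (simp add: subset_iff cong: image_cong)
    then show ?thesis by (simp add: image_Un)
  qed
  moreover have "compact (k ` (I \<union> h ` J))"
    using h \<open>compact (I \<union> h ` J)\<close> by (meson compact_continuous_image continuous_on_subset homeomorphism_def subset_UNIV)
  ultimately have cl: "closed (k ` I \<union> J)"
    by (simp add: compact_imp_closed)
  obtain T where T: "open T" "k ` I = S2 \<inter> T"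
    using punctured_S2_open_preimage[OF h \<open>open I\<close>] .
  have "U \<subseteq> T \<union> - (k ` I \<union> J)"
    using T(2) U(2,4) unfolding J_def by blast
  moreover have "T \<inter> - (k ` I \<union> J) \<inter> U = {}"
    using T(2) U(2) by blast
  ultimately have "T \<inter> U = {} \<or> - (k ` I \<union> J) \<inter> U = {}"
    using connectedD[OF U(1) T(1), of "- (k ` I \<union> J)"] cl by (metis open_Compl)
  moreover have "q \<in> - (k ` I \<union> J)"
    using hk(3) g(3) unfolding J_def by blast
  ultimately have "T \<inter> U = {}"
    using U(3) by blast
  then have "T \<inter> closure U = {}"
    using T(1) by (simp add: open_Int_closure_eq_empty)
  then have "k ` I \<inter> A = {}"
    using T(2) A(2) by blast
  moreover have "a \<in> k ` I" if "a \<in> S2 - {q}" "h a \<in> I" for a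
    using hk(1)[OF that(1)] that(2) by (metis imageI)
  ultimately show ?thesis
    unfolding im I_def[symmetric] using A(1) by blast
qed

text \<open>The triangle inequality makes the closed caps of radius \<open>r\<close> disjoint, and a
  closed cap minus \<open>q\<close> has a closed image in the plane, even when \<open>q\<close> lies
  in the cap.\<close>

lemma homeomorphic_image_closure_disjoint_caps:
  assumes h: "homeomorphism (S2 - {q}) (UNIV :: complex set) h k"
    and xy: "x \<in> S2" "y \<in> S2" and r: "r < rho x y / 2"
  shows "closure (h ` (Dball r x - {q})) \<inter> closure (h ` (Dball r y - {q})) = {}"
proof -
  define c where "c = (\<lambda>v. {w \<in> S2. rho v w \<le> r})"
  have sub: "closure (h ` (Dball r v - {q})) \<subseteq> h ` (c v - {q})" if "v \<in> S2" for v
  proof (rule closure_minimal)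
    show "h ` (Dball r v - {q}) \<subseteq> h ` (c v - {q})"
      by (auto simp: c_def Dball_def)
    show "closed (h ` (c v - {q}))"
      using closed_rho_le[OF that] unfolding c_def by (intro punctured_S2_closed_image[OF h]) auto
  qed
  have disj: "c x \<inter> c y = {}"
  proof (rule ccontr)
    assume "c x \<inter> c y \<noteq> {}"
    then obtain w where w: "w \<in> S2" "rho x w \<le> r" "rho y w \<le> r"
      by (auto simp: c_def)
    then have "rho x y \<le> r + r"
      using rho_triangle[OF xy w(1)] rho_commute[of w y] by linarith
    then show False using r by simp
  qed
  have inj: "inj_on h (S2 - {q})"
    using h unfolding homeomorphism_def by (metis inj_on_inverseI)
  have "h ` (c x - {q}) \<inter> h ` (c y - {q}) = h ` ((c x - {q}) \<inter> (c y - {q}))"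
    by (rule inj_on_image_Int[OF inj, symmetric]) (auto simp: c_def)
  also have "\<dots> = {}"
    using disj by blast
  finally show ?thesis
    using sub[OF xy(1)] sub[OF xy(2)] by blast
qed

text \<open>The puncture is a point \<open>q\<close> of \<open>U\<close> outside \<open>K\<close>:
  the image of \<open>K\<close> is then compact in the plane, and the annulus contains infinity, as
  the planar crossing theorem expects. The components found there are carried back by
  \<open>k\<close>.\<close>

lemma infinite_crossing_of_schoenflies_rel:
  assumes K: "K \<subseteq> S2" "compact K" and xy: "x \<in> S2" "y \<in> S2" and r: "r < rho x y / 2"
    and R: "(u, v) \<in> schoenflies_rel K" "u \<in> Dball r x" "v \<in> Dball r y"
  shows "infinite {P \<in> components (K - (Dball r x \<union> Dball r y)).
                   P \<inter> sbd (Dball r x) \<noteq> {} \<and> P \<inter> sbd (Dball r y) \<noteq> {}}"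
    (is "infinite ?CC")
proof -
  obtain J1 J2 U P L where J: "J1 \<subseteq> S2" "J2 \<subseteq> S2" "simple_closed_curve J1" "simple_closed_curve J2"
      "u \<in> J1" "v \<in> J2" and U: "is_U J1 J2 U"
    and P: "inj P" "\<And>n. P n \<in> components (closure U \<inter> K)"
    and L: "hausdorff_lim P L" "u \<in> L" "v \<in> L" and uv: "u \<in> K" "v \<in> K"
    using R(1) unfolding schoenflies_rel_def by (smt (verit) mem_Collect_eq prod.inject insert_subset)
  obtain g1 where g1: "simple_path g1" "pathfinish g1 = pathstart g1" "path_image g1 = J1"
    using J(3) by (auto simp: simple_closed_curve_def)
  obtain g2 where g2: "simple_path g2" "pathfinish g2 = pathstart g2" "path_image g2 = J2"
    using J(4) by (auto simp: simple_closed_curve_def)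
  have Uc: "U \<in> components (S2 - (J1 \<union> J2))" and sbdU: "sbd U = J1 \<union> J2"
    using U by (auto simp: is_U_def)
  then have U': "connected U" "U \<subseteq> S2 - (J1 \<union> J2)" "U \<noteq> {}"
    using in_components_connected in_components_subset in_components_nonempty by blast+
  have clJ: "closed (J1 \<union> J2)"
    using g1 g2 by (metis closed_Un closed_simple_path_image)
  have opS: "openin (top_of_set S2) (S2 - (J1 \<union> J2))"
    using openin_open_Int[of "- (J1 \<union> J2)" S2] clJ unfolding Diff_eq by blast
  have "locally connected (S2 - (J1 \<union> J2))"
    using locally_open_subset[OF locally_connected_sphere opS] .
  then have "openin (top_of_set (S2 - (J1 \<union> J2))) U"
    using Uc openin_components_locally_connected by blast
  then have Uo: "openin (top_of_set S2) U"
    using opS openin_trans by blast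
  have clU: "closure U \<subseteq> S2"
    using U'(2) by (intro closure_minimal) auto
  then have clU_eq: "closure U = U \<union> (J1 \<union> J2)"
    using sbd_eq[OF Uo] sbdU closure_subset[of U] by blast
  \<comment> \<open>If \<open>K\<close> contained \<open>U\<close>, the connected set
    \<open>closure U\<close> would be the only component available, but \<open>P 0\<close> and
    \<open>P 1\<close> differ.\<close>
  have "\<not> U \<subseteq> K"
  proof
    assume "U \<subseteq> K"
    then have "closure U \<subseteq> K"
      using K(2) by (simp add: closure_minimal compact_imp_closed)
    then have "closure U \<inter> K = closure U" by blast
    moreover have "components (closure U) = {closure U}"
      using U'(1,3) by (simp add: components_eq_sing_iff connected_imp_connected_closure)
    ultimately have "P 0 = P 1"
      using P(2)[of 0] P(2)[of 1] by simp
    then show False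
      using P(1) by (simp add: inj_eq)
  qed
  then obtain q where q: "q \<in> U" "q \<notin> K" by blast
  then have qS: "q \<in> S2" "q \<notin> J1" "q \<notin> J2"
    using U'(2) by auto
  obtain h :: "real^3 \<Rightarrow> complex" and k where h: "homeomorphism (S2 - {q}) UNIV h k"
    using punctured_S2_homeomorphism[OF qS(1)] .
  have hk: "k (h a) = a" if "a \<in> S2 - {q}" for a
    using h that unfolding homeomorphism_def by blast
  have kh: "h (k b) = b" "k b \<in> S2 - {q}" for b
    using h unfolding homeomorphism_def by blast+
  have conth: "continuous_on (S2 - {q}) h" and contk: "continuous_on UNIV k"
    using h unfolding homeomorphism_def by blast+
  have inj: "inj_on h (S2 - {q})"
    using hk by (rule inj_on_inverseI)
  have KS: "K \<subseteq> S2 - {q}" and JS: "J1 \<subseteq> S2 - {q}" "J2 \<subseteq> S2 - {q}"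
    using K(1) q(2) J qS by blast+
  have curve: "simple_path (h \<circ> g)" "pathfinish (h \<circ> g) = pathstart (h \<circ> g)"
    if "simple_path g" "pathfinish g = pathstart g" "path_image g \<subseteq> S2 - {q}" for g
  proof -
    show "simple_path (h \<circ> g)"
      using that conth inj
      by (intro simple_path_continuous_image) (auto intro: continuous_on_subset inj_on_subset)
    show "pathfinish (h \<circ> g) = pathstart (h \<circ> g)"
      using that(2) by (simp add: pathfinish_def pathstart_def)
  qed
  define A where "A = h ` (closure U - {q})"
  define D where "D = Dball r x"
  define E where "E = Dball r y"
  define D' where "D' = h ` (D - {q})"
  define E' where "E' = h ` (E - {q})"
  have DS: "openin (top_of_set S2) D" "openin (top_of_set S2) E" "D \<subseteq> S2" "E \<subseteq> S2"
    using openin_Dball xy by (auto simp: D_def E_def Dball_def)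
  have uvD: "u \<in> D" "v \<in> E"
    using R by (auto simp: D_def E_def)
  have uvS: "u \<in> S2 - {q}" "v \<in> S2 - {q}"
    using uv KS by blast+
  have "infinite {C \<in> components (h ` K - (D' \<union> E')). C \<inter> closure D' \<noteq> {} \<and> C \<inter> closure E' \<noteq> {}}"
  proof (rule infinitely_many_crossing_components[of "h ` K" A "h \<circ> g1" "h \<circ> g2" D' E' "h u" "h v" "\<lambda>n. h ` P n"])
    show "compact (h ` K)"
      using K(2) KS conth by (meson compact_continuous_image continuous_on_subset)
    show clA: "closed A"
      unfolding A_def using clU by (intro punctured_S2_closed_image[OF h]) auto
    show "frontier A \<subseteq> path_image (h \<circ> g1) \<union> path_image (h \<circ> g2)"
    proof -
      have "open (h ` (U - {q}))"
        by (rule punctured_S2_open_image[OF h Uo])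
      moreover have "h ` (U - {q}) \<subseteq> A"
        unfolding A_def using closure_subset[of U] by blast
      ultimately have "h ` (U - {q}) \<subseteq> interior A"
        by (simp add: interior_maximal)
      then have "frontier A \<subseteq> A - h ` (U - {q})"
        using clA by (auto simp: frontier_def)
      also have "\<dots> \<subseteq> h ` (J1 \<union> J2)"
        unfolding A_def clU_eq by blast
      finally show ?thesis
        using g1(3) g2(3) by (simp add: path_image_compose image_Un)
    qed
    show "A \<inter> inside (path_image (h \<circ> g1)) = {}"
      unfolding A_def using g1 JS(1) U' clU q(1) by (intro punctured_S2_inside_disjoint[OF h]) auto
    show "A \<inter> inside (path_image (h \<circ> g2)) = {}"
      unfolding A_def using g2 JS(2) U' clU q(1) by (intro punctured_S2_inside_disjoint[OF h]) auto
    show "open D'" "open E'"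
      unfolding D'_def E'_def by (intro punctured_S2_open_image[OF h] DS)+
    show "closure D' \<inter> closure E' = {}"
      unfolding D'_def E'_def D_def E_def
      by (rule homeomorphic_image_closure_disjoint_caps[OF h xy r])
    show "h u \<in> D'" "h v \<in> E'"
      using uvD uvS unfolding D'_def E'_def by blast+
    have PS: "P n \<subseteq> S2 - {q}" for n
      using in_components_subset[OF P(2)] KS by blast
    show "inj (\<lambda>n. h ` P n)"
    proof (rule injI)
      fix n m assume "h ` P n = h ` P m"
      then have "P n = P m"
        using inj_on_image_eq_iff[OF inj PS PS] by blast
      then show "n = m" using P(1) by (simp add: inj_eq)
    qed
    have eq: "h ` K \<inter> A = h ` (closure U \<inter> K)"
    proof -
      have "h ` K \<inter> A = h ` (K \<inter> (closure U - {q}))"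
        unfolding A_def using KS clU by (intro inj_on_image_Int[OF inj, symmetric]) auto
      moreover have "K \<inter> (closure U - {q}) = closure U \<inter> K"
        using q(2) by blast
      ultimately show ?thesis by simp
    qed
    have hom: "homeomorphism (closure U \<inter> K) (h ` (closure U \<inter> K)) h k"
      using KS by (intro homeomorphism_of_subsets[OF h]) auto
    show "h ` P n \<in> components (h ` K \<inter> A)" for n
      unfolding eq using homeomorphism_image_components[OF hom P(2)] .
    \<comment> \<open>Points of \<open>L\<close> are approximated by points of \<open>P n\<close> in
      \<open>rho\<close>, hence in the chordal distance, and so eventually within any neighbourhood
      pulled back from the plane.\<close>
    have near: "\<forall>\<^sub>F n in sequentially. h ` P n \<inter> G \<noteq> {}"
      if G: "open G" "h w \<in> G" and w: "w \<in> L" "w \<in> S2 - {q}" for G w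
    proof -
      obtain T where T: "open T" "k ` G = S2 \<inter> T"
        using punctured_S2_open_preimage[OF h G(1)] .
      have "w \<in> k ` G"
        using hk[OF w(2)] G(2) by (metis imageI)
      then obtain e where e: "e > 0" "ball w e \<subseteq> T"
        using T open_contains_ball by blast
      have "\<forall>\<^sub>F n in sequentially. (\<forall>a\<in>P n. \<exists>b\<in>L. rho a b < e) \<and> (\<forall>b\<in>L. \<exists>a\<in>P n. rho a b < e)"
        using L(1) e(1) by (auto simp: hausdorff_lim_def)
      then show ?thesis
      proof (rule eventually_mono)
        fix n assume "(\<forall>a\<in>P n. \<exists>b\<in>L. rho a b < e) \<and> (\<forall>b\<in>L. \<exists>a\<in>P n. rho a b < e)"
        then obtain a where a: "a \<in> P n" "rho a w < e"
          using w(1) by blast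
        then have "a \<in> S2" using PS by blast
        moreover have "dist a w < e"
          using dist_le_rho[of a w] a(2) \<open>a \<in> S2\<close> w(2) by auto
        ultimately have "a \<in> k ` G"
          using e(2) T(2) by (auto simp: dist_commute)
        then have "h a \<in> G" using kh(1) by auto
        then show "h ` P n \<inter> G \<noteq> {}" using a(1) by blast
      qed
    qed
    show "\<forall>\<^sub>F n in sequentially. h ` P n \<inter> G \<noteq> {}" if "open G" "h u \<in> G" for G
      using near[OF that L(2) uvS(1)] .
    show "\<forall>\<^sub>F n in sequentially. h ` P n \<inter> G \<noteq> {}" if "open G" "h v \<in> G" for G
      using near[OF that L(3) uvS(2)] .
  qed (use curve g1 g2 JS in auto)
  \<comment> \<open>Every planar crossing component is the image of a spherical one, so finitely
    many of the latter would leave only finitely many of the former.\<close>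
  moreover have "{C \<in> components (h ` K - (D' \<union> E')). C \<inter> closure D' \<noteq> {} \<and> C \<inter> closure E' \<noteq> {}}
      \<subseteq> (\<lambda>C. h ` C) ` ?CC"
  proof
    fix C assume C: "C \<in> {C \<in> components (h ` K - (D' \<union> E')). C \<inter> closure D' \<noteq> {} \<and> C \<inter> closure E' \<noteq> {}}"
    have eq: "h ` K - (D' \<union> E') = h ` (K - (D \<union> E))"
    proof -
      have "h ` (K - ((D \<union> E) - {q})) = h ` K - h ` ((D \<union> E) - {q})"
        using KS DS by (intro inj_on_image_set_diff[OF inj]) auto
      moreover have "K - ((D \<union> E) - {q}) = K - (D \<union> E)"
        using q(2) by blast
      moreover have "h ` ((D \<union> E) - {q}) = D' \<union> E'"
        unfolding D'_def E'_def by blast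
      ultimately show ?thesis by simp
    qed
    have hom: "homeomorphism (h ` (K - (D \<union> E))) (K - (D \<union> E)) k h"
      by (rule homeomorphism_symD[OF homeomorphism_of_subsets[OF h]]) (use KS in auto)
    have kC: "k ` C \<in> components (K - (D \<union> E))"
      using homeomorphism_image_components[OF hom, of C] C eq by simp
    have kCs: "k ` C \<subseteq> K - (D \<union> E)"
      by (rule in_components_subset[OF kC])
    have "k ` C \<inter> sbd B \<noteq> {}"
      if B: "openin (top_of_set S2) B" "B \<subseteq> S2" "B \<subseteq> D \<union> E" "C \<inter> closure (h ` (B - {q})) \<noteq> {}" for B
    proof -
      obtain c where c: "c \<in> C" "c \<in> closure (h ` (B - {q}))"
        using B(4) by blast
      have "k ` (h ` (B - {q})) \<subseteq> closure B"
        using hk B(2) closure_subset[of B] by force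
      then have "k ` closure (h ` (B - {q})) \<subseteq> closure B"
        using contk by (intro image_closure_subset) (auto intro: continuous_on_subset)
      then have "k c \<in> closure B" using c(2) by blast
      moreover have "k c \<in> S2" "k c \<notin> B"
        using kCs c(1) K(1) B(3) by blast+
      ultimately show ?thesis
        using c(1) unfolding sbd_eq[OF B(1)] by blast
    qed
    from this[OF DS(1,3)] this[OF DS(2,4)] have "k ` C \<inter> sbd D \<noteq> {}" "k ` C \<inter> sbd E \<noteq> {}"
      using C unfolding D'_def E'_def by blast+
    with kC have "k ` C \<in> ?CC"
      unfolding D_def E_def by blast
    moreover have "C = h ` k ` C"
      using kh(1) by (simp add: image_image)
    ultimately show "C \<in> (\<lambda>C. h ` C) ` ?CC" by blast
  qed
  ultimately show ?thesis
    by (meson finite_imageI finite_subset)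
qed

section \<open>Caps and annuli\<close>

lemma image_left_inverse:
  assumes "\<And>a. a \<in> B \<Longrightarrow> k (h a) = a"
  shows "k ` h ` B = B"
  using assms by (force simp: image_image)

text \<open>The frame is the image of the standard basis under an orthogonal map that sends the
  first basis vector to \<open>x\<close>.\<close>

lemma orthonormal_frame:
  fixes x :: "real^3"
  assumes "x \<in> S2"
  obtains a b where "x \<bullet> x = 1" "a \<bullet> a = 1" "b \<bullet> b = 1" "x \<bullet> a = 0" "x \<bullet> b = 0" "a \<bullet> b = 0"
    "\<And>w. w = (w \<bullet> x) *\<^sub>R x + (w \<bullet> a) *\<^sub>R a + (w \<bullet> b) *\<^sub>R b"
proof -
  obtain f where f: "orthogonal_transformation f" "f (axis 1 1 :: real^3) = x"
    using orthogonal_transformation_exists_1[of "axis 1 1 :: real^3" x] assms by auto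
  define a where "a = f (axis 2 1)"
  define b where "b = f (axis 3 1)"
  have dot: "f v \<bullet> f w = v \<bullet> w" for v w
    using f(1) by (simp add: orthogonal_transformation_def)
  have lin: "linear f"
    using f(1) by (rule orthogonal_transformation_linear)
  have exp: "w = (w \<bullet> x) *\<^sub>R x + (w \<bullet> a) *\<^sub>R a + (w \<bullet> b) *\<^sub>R b" for w
  proof -
    obtain v where v: "w = f v"
      using orthogonal_transformation_surj[OF f(1)] by (metis surjD)
    have "v = (v $ 1) *\<^sub>R axis 1 1 + (v $ 2) *\<^sub>R axis 2 1 + (v $ 3) *\<^sub>R axis 3 1"
      using basis_expansion[of v] by (simp add: sum_3 scalar_mult_eq_scaleR)
    then have "f v = f ((v $ 1) *\<^sub>R axis 1 1 + (v $ 2) *\<^sub>R axis 2 1 + (v $ 3) *\<^sub>R axis 3 1)"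
      by simp
    also have "\<dots> = (v $ 1) *\<^sub>R x + (v $ 2) *\<^sub>R a + (v $ 3) *\<^sub>R b"
      unfolding a_def b_def f(2)[symmetric] by (simp only: linear_add[OF lin] linear_scale[OF lin])
    finally have "f v = (v $ 1) *\<^sub>R x + (v $ 2) *\<^sub>R a + (v $ 3) *\<^sub>R b" .
    moreover have "w \<bullet> x = v $ 1" "w \<bullet> a = v $ 2" "w \<bullet> b = v $ 3"
      unfolding v a_def b_def f(2)[symmetric] dot by (simp_all add: inner_axis)
    ultimately show ?thesis
      using v by simp
  qed
  have "x \<bullet> x = 1" "a \<bullet> a = 1" "b \<bullet> b = 1" "x \<bullet> a = 0" "x \<bullet> b = 0" "a \<bullet> b = 0"
    unfolding a_def b_def f(2)[symmetric] dot by (simp_all add: inner_axis_axis)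
  then show thesis
    using that exp by blast
qed

text \<open>Geodesic polar coordinates about \<open>x\<close>: \<open>t\<close> is the distance from
  \<open>x\<close>, and the unit complex number \<open>z\<close> is a direction in the tangent plane
  spanned by \<open>a\<close> and \<open>b\<close>.\<close>

lemma polar_coordinates:
  assumes x: "x \<in> S2"
  obtains F :: "real \<Rightarrow> complex \<Rightarrow> real^3" where
    "continuous_on UNIV (\<lambda>(t,z). F t z)"
    "\<And>t z. cmod z = 1 \<Longrightarrow> F t z \<in> S2"
    "\<And>t z. cmod z = 1 \<Longrightarrow> 0 \<le> t \<Longrightarrow> t \<le> pi \<Longrightarrow> rho x (F t z) = t"
    "\<And>w. w \<in> S2 \<Longrightarrow> \<exists>z. cmod z = 1 \<and> F (rho x w) z = w"
    "\<And>t. 0 < t \<Longrightarrow> t < pi \<Longrightarrow> inj (F t)"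
proof -
  obtain a b where ab: "x \<bullet> x = 1" "a \<bullet> a = 1" "b \<bullet> b = 1" "x \<bullet> a = 0" "x \<bullet> b = 0" "a \<bullet> b = 0"
    and exp: "\<And>w. w = (w \<bullet> x) *\<^sub>R x + (w \<bullet> a) *\<^sub>R a + (w \<bullet> b) *\<^sub>R b"
    using orthonormal_frame[OF x] by metis
  have ab': "a \<bullet> x = 0" "b \<bullet> x = 0" "b \<bullet> a = 0"
    using ab by (simp_all add: inner_commute)
  define F where "F = (\<lambda>t z. cos t *\<^sub>R x + sin t *\<^sub>R (Re z *\<^sub>R a + Im z *\<^sub>R b))"
  have Fx: "F t z \<bullet> x = cos t" "F t z \<bullet> a = sin t * Re z" "F t z \<bullet> b = sin t * Im z" for t z
    unfolding F_def by (simp_all add: inner_add_left ab ab')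
  have nrm: "w \<bullet> w = (w \<bullet> x)\<^sup>2 + (w \<bullet> a)\<^sup>2 + (w \<bullet> b)\<^sup>2" for w
  proof -
    have "w \<bullet> w = w \<bullet> ((w \<bullet> x) *\<^sub>R x + (w \<bullet> a) *\<^sub>R a + (w \<bullet> b) *\<^sub>R b)"
      using exp[of w] by simp
    then show ?thesis
      by (simp add: inner_add_right power2_eq_square)
  qed
  have S: "F t z \<in> S2" if "cmod z = 1" for t z
  proof -
    have "(Re z)\<^sup>2 + (Im z)\<^sup>2 = 1"
      using that by (simp add: cmod_def)
    then have "(sin t)\<^sup>2 * ((Re z)\<^sup>2 + (Im z)\<^sup>2) = (sin t)\<^sup>2"
      by simp
    then have "F t z \<bullet> F t z = 1"
      unfolding nrm[of "F t z"] Fx using sin_cos_squared_add2[of t]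
      by (simp only: power_mult_distrib distrib_left add.assoc)
    then show ?thesis by (simp add: norm_eq_1)
  qed
  show thesis
  proof (rule that[of F])
    show "continuous_on UNIV (\<lambda>(t,z). F t z)"
      unfolding F_def case_prod_unfold by (intro continuous_intros)
    show "F t z \<in> S2" if "cmod z = 1" for t z
      using S[OF that] .
    show "rho x (F t z) = t" if "cmod z = 1" "0 \<le> t" "t \<le> pi" for t z
      unfolding rho_def inner_commute[of x] Fx using that by (simp add: arccos_cos)
    show "inj (F t)" if "0 < t" "t < pi" for t
    proof (rule injI)
      fix z z' assume "F t z = F t z'"
      then have "sin t * Re z = sin t * Re z'" "sin t * Im z = sin t * Im z'"
        using Fx(2,3)[of t] by metis+
      then show "z = z'"
        using sin_gt_zero[OF that] by (simp add: complex_eq_iff)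
    qed
    show "\<exists>z. cmod z = 1 \<and> F (rho x w) z = w" if w: "w \<in> S2" for w
    proof -
      define t where "t = rho x w"
      have ct: "cos t = w \<bullet> x"
        using cos_rho[OF x w] by (simp add: t_def inner_commute)
      have ww: "w \<bullet> w = 1" using w by (simp add: norm_eq_1)
      have sq: "(w \<bullet> a)\<^sup>2 + (w \<bullet> b)\<^sup>2 = (sin t)\<^sup>2"
        using nrm[of w] ww ct sin_squared_eq[of t] by simp
      obtain z where z: "cmod z = 1" "sin t * Re z = w \<bullet> a" "sin t * Im z = w \<bullet> b"
      proof (cases "sin t = 0")
        \<comment> \<open>At \<open>x\<close> and its antipode all directions give the same point,
          so \<open>z = 1\<close> serves.\<close>
        case True
        then show ?thesis
          using sq that[of 1] by (simp add: sum_power2_eq_zero_iff)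
      next
        case False
        define z where "z = Complex ((w \<bullet> a) / sin t) ((w \<bullet> b) / sin t)"
        have "((w \<bullet> a) / sin t)\<^sup>2 + ((w \<bullet> b) / sin t)\<^sup>2 = 1"
          using sq False by (simp add: power_divide flip: add_divide_distrib)
        then have "cmod z = 1" by (simp add: z_def cmod_def)
        then show ?thesis
          using that[of z] False by (simp add: z_def)
      qed
      have "F t z = (w \<bullet> x) *\<^sub>R x + (w \<bullet> a) *\<^sub>R a + (w \<bullet> b) *\<^sub>R b"
        unfolding F_def ct[symmetric] z(2,3)[symmetric] by (simp add: scaleR_add_right)
      then have "F t z = w"
        using exp[of w] by simp
      then show ?thesis
        using z(1) by (auto simp: t_def)
    qed
  qed
qed

lemma simple_closed_curve_circle:
  assumes x: "x \<in> S2" and r: "0 < r" "r < pi"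
  shows "simple_closed_curve {w \<in> S2. rho x w = r}"
proof -
  obtain F :: "real \<Rightarrow> complex \<Rightarrow> real^3" where F: "continuous_on UNIV (\<lambda>(t,z). F t z)"
    "\<And>t z. cmod z = 1 \<Longrightarrow> F t z \<in> S2"
    "\<And>t z. cmod z = 1 \<Longrightarrow> 0 \<le> t \<Longrightarrow> t \<le> pi \<Longrightarrow> rho x (F t z) = t"
    "\<And>w. w \<in> S2 \<Longrightarrow> \<exists>z. cmod z = 1 \<and> F (rho x w) z = w"
    "\<And>t. 0 < t \<Longrightarrow> t < pi \<Longrightarrow> inj (F t)"
    using polar_coordinates[OF x] by metis
  have eq: "{w \<in> S2. rho x w = r} = F r ` sphere 0 1"
  proof
    show "{w \<in> S2. rho x w = r} \<subseteq> F r ` sphere 0 1"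
    proof
      fix w assume "w \<in> {w \<in> S2. rho x w = r}"
      then show "w \<in> F r ` sphere 0 1"
        using F(4)[of w] by (force simp: dist_norm)
    qed
    show "F r ` sphere 0 1 \<subseteq> {w \<in> S2. rho x w = r}"
      using F(2)[of _ r] F(3)[of _ r] r by auto
  qed
  define g where "g = F r \<circ> circlepath 0 1"
  have cont: "continuous_on UNIV (F r)"
    using continuous_on_compose2[OF F(1), of UNIV "\<lambda>z. (r, z)"] by (simp add: continuous_on_Pair)
  have "simple_path g"
    unfolding g_def using F(5)[OF r] cont
    by (intro simple_path_continuous_image)
      (auto simp: simple_path_circlepath intro: continuous_on_subset inj_on_subset)
  moreover have "pathfinish g = pathstart g"
    by (simp add: g_def pathfinish_compose pathstart_compose)
  moreover have "path_image g = {w \<in> S2. rho x w = r}"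
    unfolding g_def path_image_compose eq by simp
  ultimately show ?thesis
    unfolding simple_closed_curve_def by blast
qed

lemma connected_cap_complement:
  assumes x: "x \<in> S2" and r: "0 \<le> r"
  shows "connected {w \<in> S2. r < rho x w}"
proof -
  obtain F :: "real \<Rightarrow> complex \<Rightarrow> real^3" where F: "continuous_on UNIV (\<lambda>(t,z). F t z)"
    "\<And>t z. cmod z = 1 \<Longrightarrow> F t z \<in> S2"
    "\<And>t z. cmod z = 1 \<Longrightarrow> 0 \<le> t \<Longrightarrow> t \<le> pi \<Longrightarrow> rho x (F t z) = t"
    "\<And>w. w \<in> S2 \<Longrightarrow> \<exists>z. cmod z = 1 \<and> F (rho x w) z = w"
    using polar_coordinates[OF x] by metis
  have "{w \<in> S2. r < rho x w} = (\<lambda>(t,z). F t z) ` ({r<..pi} \<times> sphere 0 1)"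
  proof
    show "{w \<in> S2. r < rho x w} \<subseteq> (\<lambda>(t,z). F t z) ` ({r<..pi} \<times> sphere 0 1)"
    proof
      fix w assume w: "w \<in> {w \<in> S2. r < rho x w}"
      then obtain z where "cmod z = 1" "F (rho x w) z = w"
        using F(4)[of w] by blast
      then show "w \<in> (\<lambda>(t,z). F t z) ` ({r<..pi} \<times> sphere 0 1)"
        using w rho_bounds[OF x, of w] by (intro image_eqI[of _ _ "(rho x w, z)"]) auto
    qed
    show "(\<lambda>(t,z). F t z) ` ({r<..pi} \<times> sphere 0 1) \<subseteq> {w \<in> S2. r < rho x w}"
      using F(2,3) r by auto
  qed
  moreover have "connected ({r<..pi} \<times> sphere (0::complex) 1)"
    by (intro connected_Times connected_sphere) auto
  ultimately show ?thesis
    using F(1) by (metis connected_continuous_image continuous_on_subset subset_UNIV)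
qed

text \<open>A point of the circle is approached along its meridian from farther out. Up to distance
  \<open>rho x y - r\<close> from \<open>x\<close> the triangle inequality keeps the meridian out of
  the closed cap at \<open>y\<close>.\<close>

lemma circle_subset_closure_annulus:
  assumes x: "x \<in> S2" and y: "y \<in> S2" and r: "0 < r" "r < rho x y / 2"
  shows "{w \<in> S2. rho x w = r} \<subseteq> closure {w \<in> S2. r < rho x w \<and> r < rho y w}"
proof
  fix w assume w: "w \<in> {w \<in> S2. rho x w = r}"
  obtain F :: "real \<Rightarrow> complex \<Rightarrow> real^3" where F: "continuous_on UNIV (\<lambda>(t,z). F t z)"
    "\<And>t z. cmod z = 1 \<Longrightarrow> F t z \<in> S2"
    "\<And>t z. cmod z = 1 \<Longrightarrow> 0 \<le> t \<Longrightarrow> t \<le> pi \<Longrightarrow> rho x (F t z) = t"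
    "\<And>w. w \<in> S2 \<Longrightarrow> \<exists>z. cmod z = 1 \<and> F (rho x w) z = w"
    using polar_coordinates[OF x] by metis
  obtain z where z: "cmod z = 1" "F r z = w"
    using F(4)[of w] w by auto
  have "continuous_on UNIV (\<lambda>t. F t z)"
    using continuous_on_compose2[OF F(1), of UNIV "\<lambda>t. (t, z)"] by (simp add: continuous_on_Pair)
  then have lim: "((\<lambda>t. F t z) \<longlongrightarrow> w) (at_right r)"
    using z(2) by (metis UNIV_I continuous_on_def tendsto_within_subset subset_UNIV)
  have ev: "\<forall>\<^sub>F t in at_right r. F t z \<in> closure {w \<in> S2. r < rho x w \<and> r < rho y w}"
  proof (rule eventually_at_rightI[of r "rho x y - r"])
    fix t assume t: "t \<in> {r<..<rho x y - r}"
    then have tb: "0 \<le> t" "t \<le> pi"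
      using r(1) rho_bounds[OF x y] by auto
    note Ft = F(2)[OF z(1), of t] F(3)[OF z(1) tb]
    have "rho x y \<le> t + rho y (F t z)"
      using rho_triangle[OF x y Ft(1)] Ft(2) rho_commute[of y] by simp
    then have "F t z \<in> {w \<in> S2. r < rho x w \<and> r < rho y w}"
      using Ft t by auto
    then show "F t z \<in> closure {w \<in> S2. r < rho x w \<and> r < rho y w}"
      by (rule subsetD[OF closure_subset])
  qed (use r in simp)
  show "w \<in> closure {w \<in> S2. r < rho x w \<and> r < rho y w}"
    by (rule Lim_in_closed_set[OF closed_closure ev _ lim]) simp
qed

text \<open>Seen from the puncture \<open>x\<close>, the closed cap at \<open>y\<close> is compact
  and the punctured closed cap at \<open>x\<close> is closed. They are disjoint and neither
  separates the plane, so by Janiszewski's theorem their union does not separate it either.\<close>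

lemma connected_annulus:
  assumes x: "x \<in> S2" and y: "y \<in> S2" and r: "0 < r" "r < rho x y / 2"
  shows "connected {w \<in> S2. r < rho x w \<and> r < rho y w}"
proof -
  define c where "c = (\<lambda>v. {w \<in> S2. rho v w \<le> r})"
  define d where "d = (\<lambda>v. {w \<in> S2. r < rho v w})"
  have rxx: "rho v v = 0" if "v \<in> S2" for v
    using that by (simp add: rho_def norm_eq_1[symmetric] power2_norm_eq_inner[symmetric])
  have xc: "x \<in> c x" "y \<in> c y" "x \<notin> c y"
    using x y r rxx rho_bounds[OF x y] rho_commute[of y x] by (auto simp: c_def)
  have cd: "c v = S2 - d v" "d v \<subseteq> S2" for v
    by (auto simp: c_def d_def)
  have clc: "closed (c v)" "c v \<subseteq> S2" if "v \<in> S2" for v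
    using closed_rho_le[OF that] by (auto simp: c_def)
  have dop: "openin (top_of_set S2) (d v)" if "v \<in> S2" for v
  proof -
    have "d v = S2 - c v" by (auto simp: c_def d_def)
    then show ?thesis
      using openin_open_Int[of "- c v" S2] clc(1)[OF that] unfolding Diff_eq by (metis open_Compl)
  qed
  have dcon: "connected (d v)" if "v \<in> S2" for v
    using connected_cap_complement[OF that] r(1) by (simp add: d_def)
  \<comment> \<open>This is the complement of the closed cap at \<open>y\<close> after puncturing at
    \<open>x\<close>. A chart punctured at \<open>y\<close> shows it as a connected open subset of
    the plane less one point.\<close>
  have "connected (d y - {x})"
  proof -
    obtain h :: "real^3 \<Rightarrow> complex" and k where h: "homeomorphism (S2 - {y}) UNIV h k"
      using punctured_S2_homeomorphism[OF y] .
    have hk: "\<And>a. a \<in> S2 - {y} \<Longrightarrow> k (h a) = a" "continuous_on (S2 - {y}) h" "continuous_on UNIV k"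
      using h unfolding homeomorphism_def by blast+
    have yd: "d y - {y} = d y" "d y \<subseteq> S2 - {y}"
      using xc(2) cd by blast+
    have "open (h ` d y)"
      using punctured_S2_open_image[OF h dop[OF y]] yd by simp
    moreover have "connected (h ` d y)"
      using dcon[OF y] hk(2) yd(2) by (meson connected_continuous_image continuous_on_subset)
    ultimately have "connected (h ` d y - {h x})"
      by (intro connected_open_delete) auto
    then have "connected (k ` (h ` d y - {h x}))"
      using hk(3) by (meson connected_continuous_image continuous_on_subset subset_UNIV)
    moreover have "k ` (h ` d y - {h x}) = d y - {x}"
    proof -
      have "x \<in> S2 - {y}"
        using x xc by blast
      then have "h a \<noteq> h x" if "a \<in> d y - {x}" for a
        using hk(1)[of a] hk(1)[of x] yd(2) that by (metis DiffD1 DiffD2 singletonI subsetD)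
      then have "h ` d y - {h x} = h ` (d y - {x})"
        by auto
      moreover have "k ` h ` (d y - {x}) = d y - {x}"
        using yd(2) by (intro image_left_inverse hk(1)) blast
      ultimately show ?thesis by simp
    qed
    ultimately show ?thesis by simp
  qed
  note dyx = this
  obtain h :: "real^3 \<Rightarrow> complex" and k where h: "homeomorphism (S2 - {x}) UNIV h k"
    using punctured_S2_homeomorphism[OF x] .
  have hk: "k (h a) = a" if "a \<in> S2 - {x}" for a
    using h that unfolding homeomorphism_def by blast
  have him: "h ` (S2 - {x}) = UNIV" and conth: "continuous_on (S2 - {x}) h" and contk: "continuous_on UNIV k"
    using h unfolding homeomorphism_def by blast+
  have inj: "inj_on h (S2 - {x})"
    using hk by (rule inj_on_inverseI)
  have compl: "- h ` B = h ` (S2 - {x} - B)" if "B \<subseteq> S2 - {x}" for B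
    using inj_on_image_set_diff[OF inj, of "S2 - {x}" B] that him by (simp add: Compl_eq_Diff_UNIV)
  have img: "connected (h ` B)" if "connected B" "B \<subseteq> S2 - {x}" for B
    using that conth by (meson connected_continuous_image continuous_on_subset)
  have cy: "c y \<subseteq> S2 - {x}" and cx: "c x - {x} \<subseteq> S2 - {x}"
    using xc clc x y by blast+
  have "connected (- (h ` c y \<union> h ` (c x - {x})))"
  proof (rule Janiszewski_connected)
    have "compact (c y)"
      using clc[OF y] by (meson bounded_sphere bounded_subset compact_eq_bounded_closed)
    then show "compact (h ` c y)"
      using conth cy by (meson compact_continuous_image continuous_on_subset)
    show "closed (h ` (c x - {x}))"
      by (rule punctured_S2_closed_image[OF h clc[OF x]])
    have "c x \<inter> c y = {}"
    proof (rule ccontr)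
      assume "c x \<inter> c y \<noteq> {}"
      then obtain w where w: "w \<in> S2" "rho x w \<le> r" "rho y w \<le> r"
        by (auto simp: c_def)
      then have "rho x y \<le> r + r"
        using rho_triangle[OF x y w(1)] rho_commute[of w y] by linarith
      then show False using r by simp
    qed
    then have "h ` c y \<inter> h ` (c x - {x}) = {}"
      using inj_on_image_Int[OF inj cy cx] by blast
    then show "connected (h ` c y \<inter> h ` (c x - {x}))" by simp
    have "S2 - {x} - c y = d y - {x}" "S2 - {x} - (c x - {x}) = d x"
      using cd xc by blast+
    then show "connected (- h ` c y)" "connected (- h ` (c x - {x}))"
      using compl[OF cy] compl[OF cx] img[of "d y - {x}"] img[of "d x"] dyx dcon[OF x] cd xc by auto
  qed
  moreover have "h ` c y \<union> h ` (c x - {x}) = h ` (c y \<union> (c x - {x}))"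
    by blast
  ultimately have "connected (h ` (S2 - {x} - (c y \<union> (c x - {x}))))"
    using compl[of "c y \<union> (c x - {x})"] cy cx by simp
  then have "connected (k ` h ` (S2 - {x} - (c y \<union> (c x - {x}))))"
    using contk by (meson connected_continuous_image continuous_on_subset subset_UNIV)
  moreover have "k ` h ` (S2 - {x} - (c y \<union> (c x - {x}))) = S2 - {x} - (c y \<union> (c x - {x}))"
    by (intro image_left_inverse hk) blast
  moreover have "S2 - {x} - (c y \<union> (c x - {x})) = {w \<in> S2. r < rho x w \<and> r < rho y w}"
    using xc(1) by (auto simp: c_def)
  ultimately show ?thesis by simp
qed

section \<open>Hausdorff limits\<close>

text \<open>The chord of an angle \<open>e'\<close> has length \<open>sqrt (2 - 2 * cos e')\<close>;
  capping \<open>e\<close> at \<open>pi\<close> stays where the cosine is decreasing. Together with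
  \<open>dist_le_rho\<close> this makes the two metrics uniformly equivalent.\<close>

lemma rho_less_if_dist_less:
  assumes "e > 0"
  obtains d where "d > 0" "\<And>a b. a \<in> S2 \<Longrightarrow> b \<in> S2 \<Longrightarrow> dist a b < d \<Longrightarrow> rho a b < e"
proof -
  define e' where "e' = min e pi"
  have e': "0 < e'" "e' \<le> pi" "e' \<le> e"
    using assms by (auto simp: e'_def)
  have c1: "cos e' < 1"
    using cos_monotone_0_pi[of 0 e'] e' by simp
  define d where "d = sqrt (2 - 2 * cos e')"
  show thesis
  proof (rule that[of d])
    show "d > 0" using c1 by (simp add: d_def)
    fix a b assume ab: "a \<in> S2" "b \<in> S2" "dist a b < d"
    have "a \<bullet> a = 1" "b \<bullet> b = 1"
      using ab by (auto simp: norm_eq_1)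
    moreover have "(dist a b)\<^sup>2 = a \<bullet> a - 2 * (a \<bullet> b) + b \<bullet> b"
      unfolding dist_norm power2_norm_eq_inner by (simp add: inner_diff_left inner_diff_right inner_commute)
    moreover have "(dist a b)\<^sup>2 < d\<^sup>2"
      using ab(3) by (intro power_strict_mono) auto
    moreover have "d\<^sup>2 = 2 - 2 * cos e'"
      using c1 by (simp add: d_def)
    ultimately have "cos e' < cos (rho a b)"
      using cos_rho[OF ab(1,2)] by linarith
    then have "rho a b < e'"
      using rho_bounds[OF ab(1,2)] e' by (subst (asm) cos_mono_less_eq) auto
    then show "rho a b < e" using e'(3) by linarith
  qed
qed

text \<open>Blaschke selection by way of Arzela-Ascoli: the distance functions of the sets
  \<open>P n\<close> are 1-Lipschitz and bounded by the diameter \<open>2\<close>, and the zero set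
  of a uniform limit is the Hausdorff limit. The last clause later places prescribed points in
  \<open>L\<close>.\<close>

lemma hausdorff_lim_subsequence:
  fixes P :: "nat \<Rightarrow> (real^3) set"
  assumes P: "\<And>n. P n \<subseteq> S2" "\<And>n. compact (P n)" "\<And>n. P n \<noteq> {}"
  obtains s L where "strict_mono s" "hausdorff_lim (P \<circ> s) L"
    "\<And>p l. (\<And>n. p n \<in> P n) \<Longrightarrow> p \<longlonglongrightarrow> l \<Longrightarrow> l \<in> L"
proof -
  obtain g s where g: "continuous_on S2 g" and s: "strict_mono (s :: nat \<Rightarrow> nat)"
    and lim: "\<And>e. 0 < e \<Longrightarrow> \<exists>N. \<forall>n x. n \<ge> N \<and> x \<in> S2 \<longrightarrow> norm (infdist x (P (s n)) - g x) < e"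
  proof (rule Arzela_Ascoli[of S2 "\<lambda>n x. infdist x (P n)" 2])
    show "compact S2" by simp
    show "norm (infdist x (P n)) \<le> 2" if "x \<in> S2" for n x
    proof -
      obtain a where a: "a \<in> P n" using P(3) by blast
      then have "infdist x (P n) \<le> dist x a" by (rule infdist_le)
      also have "\<dots> \<le> norm x + norm a"
        unfolding dist_norm by (rule norm_triangle_ineq4)
      also have "\<dots> \<le> 2" using that a P(1)[of n] by auto
      finally show ?thesis by (simp add: infdist_nonneg)
    qed
    show "\<exists>d>0. \<forall>n y. y \<in> S2 \<and> norm (x - y) < d \<longrightarrow> norm (infdist x (P n) - infdist y (P n)) < e"
      if "x \<in> S2" "0 < e" for x e
    proof (intro exI[of _ e] conjI allI impI)
      fix n y assume "y \<in> S2 \<and> norm (x - y) < e"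
      then show "norm (infdist x (P n) - infdist y (P n)) < e"
        using infdist_triangle_abs[of x "P n" y] unfolding dist_norm real_norm_def by linarith
    qed (use that in simp)
  qed blast
  define L where "L = {x \<in> S2. g x = 0}"
  have "closed L"
    unfolding L_def using continuous_closed_preimage_constant[OF g] by auto
  then have cL: "compact L"
    unfolding L_def by (metis (no_types, lifting) bounded_sphere bounded_subset compact_eq_bounded_closed
        mem_Collect_eq subsetI)
  \<comment> \<open>The extra subsequence \<open>t\<close> serves the proof that \<open>L\<close> is
    nonempty, where a selection converges only along a subsequence; the identity in its place gives
    \<open>pts\<close>.\<close>
  have inL: "l \<in> L" if p: "\<And>n. p n \<in> P (s (t n))" "strict_mono t" "p \<longlonglongrightarrow> l" for p l and t :: "nat \<Rightarrow> nat"
  proof -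
    have lS: "l \<in> S2"
      using closed_sequentially[OF closed_sphere _ p(3), of 0 1] p(1) P(1) by blast
    have "\<bar>g l\<bar> \<le> 0"
    proof (rule field_le_epsilon)
      fix e :: real assume e: "e > 0"
      obtain N where N: "\<And>n x. n \<ge> N \<Longrightarrow> x \<in> S2 \<Longrightarrow> norm (infdist x (P (s n)) - g x) < e / 2"
        using lim[of "e / 2"] e by auto
      obtain M where M: "\<And>n. n \<ge> M \<Longrightarrow> dist (p n) l < e / 2"
        using p(3) e unfolding lim_sequentially by (meson half_gt_zero)
      define n where "n = max N M"
      have "t n \<ge> N"
        using strict_mono_imp_increasing[OF p(2), of n] by (simp add: n_def)
      then have "norm (infdist l (P (s (t n))) - g l) < e / 2"
        using N lS by blast
      moreover have "infdist l (P (s (t n))) < e / 2"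
        using infdist_le[OF p(1)[of n], of l] M[of n] by (simp add: dist_commute n_def)
      ultimately show "\<bar>g l\<bar> \<le> 0 + e"
        using infdist_nonneg[of l "P (s (t n))"] unfolding real_norm_def by linarith
    qed
    then show ?thesis using lS by (simp add: L_def)
  qed
  have pts: "l \<in> L" if p: "\<And>n. p n \<in> P n" "p \<longlonglongrightarrow> l" for p l
    using inL[of "p \<circ> s" id l] p LIMSEQ_subseq_LIMSEQ[OF p(2) s] by (simp add: strict_mono_def)
  have "L \<noteq> {}"
  proof -
    have "\<forall>n. \<exists>a. a \<in> P (s n)"
      using P(3) by blast
    then obtain p where p: "\<And>n. p n \<in> P (s n)"
      by metis
    then have "\<forall>n. p n \<in> S2" using P(1) by blast
    then obtain l t where "strict_mono (t :: nat \<Rightarrow> nat)" "(p \<circ> t) \<longlonglongrightarrow> l"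
      using compact_sphere unfolding compact_def by metis
    then show ?thesis
      using inL[of "p \<circ> t" t l] p by auto
  qed
  have "hausdorff_lim (P \<circ> s) L"
    unfolding hausdorff_lim_def
  proof (intro conjI allI impI)
    show "compact L" by (rule cL)
    show "L \<noteq> {}" by fact
    fix e :: real assume "e > 0"
    then obtain d where d: "d > 0" "\<And>a b. a \<in> S2 \<Longrightarrow> b \<in> S2 \<Longrightarrow> dist a b < d \<Longrightarrow> rho a b < e"
      using rho_less_if_dist_less by metis
    \<comment> \<open>On the compact set \<open>M\<close> of points far from \<open>L\<close> the
      limit function is bounded away from zero by some \<open>m\<close>. A point of
      \<open>P (s n)\<close> has distance zero from that set, so for large \<open>n\<close> it
      cannot lie in \<open>M\<close>.\<close>
    define M where "M = {x \<in> S2. d \<le> infdist x L}"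
    have "compact M"
    proof -
      have "closed ({x. d \<le> infdist x L})"
        by (intro closed_Collect_le continuous_intros)
      then have "compact (S2 \<inter> {x. d \<le> infdist x L})"
        by (intro compact_Int_closed) auto
      then show ?thesis by (simp add: M_def Int_def)
    qed
    have "\<exists>m>0. \<forall>x\<in>M. m \<le> \<bar>g x\<bar>"
    proof (cases "M = {}")
      case False
      have "continuous_on M (\<lambda>x. \<bar>g x\<bar>)"
        using g by (intro continuous_intros) (auto intro: continuous_on_subset simp: M_def)
      then obtain x where x: "x \<in> M" "\<And>y. y \<in> M \<Longrightarrow> \<bar>g x\<bar> \<le> \<bar>g y\<bar>"
        using continuous_attains_inf[OF \<open>compact M\<close> False] by blast
      have "g x \<noteq> 0"
      proof
        assume "g x = 0"
        then have "x \<in> L" using x(1) by (simp add: M_def L_def)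
        then have "infdist x L = 0" by simp
        then show False using x(1) d(1) by (simp add: M_def)
      qed
      then show ?thesis using x(2) by (intro exI[of _ "\<bar>g x\<bar>"]) auto
    qed (auto intro: exI[of _ 1])
    then obtain m where m: "m > 0" "\<And>x. x \<in> M \<Longrightarrow> m \<le> \<bar>g x\<bar>" by blast
    \<comment> \<open>The bound \<open>m\<close> will keep the sets close to \<open>L\<close>, the
      bound \<open>d\<close> will keep \<open>L\<close> close to the sets.\<close>
    obtain N where N: "\<And>n x. n \<ge> N \<Longrightarrow> x \<in> S2 \<Longrightarrow> norm (infdist x (P (s n)) - g x) < min m d"
      using lim[of "min m d"] m(1) d(1) by auto
    show "\<forall>\<^sub>F n in sequentially. (\<forall>a\<in>(P \<circ> s) n. \<exists>b\<in>L. rho a b < e) \<and> (\<forall>b\<in>L. \<exists>a\<in>(P \<circ> s) n. rho a b < e)"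
      unfolding eventually_sequentially
    proof (intro exI[of _ N] allI impI conjI ballI)
      fix n a assume n: "N \<le> n" and a: "a \<in> (P \<circ> s) n"
      then have aS: "a \<in> S2" using subsetD[OF P(1)] by simp
      have "infdist a (P (s n)) = 0" using a by simp
      then have "\<bar>g a\<bar> < m"
        using N[OF n aS] by auto
      then have "a \<notin> M" using m(2)[of a] by auto
      then have "infdist a L < d" using aS by (simp add: M_def)
      moreover obtain b where "b \<in> L" "infdist a L = dist a b"
        using infdist_attains_inf[OF \<open>closed L\<close> \<open>L \<noteq> {}\<close>] by metis
      ultimately have "b \<in> L" "rho a b < e"
        using d(2)[OF aS, of b] by (auto simp: L_def)
      then show "\<exists>b\<in>L. rho a b < e" by blast
    next
      fix n b assume n: "N \<le> n" and b: "b \<in> L"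
      then have bS: "b \<in> S2" "g b = 0" by (auto simp: L_def)
      have "infdist b (P (s n)) < d"
        using N[OF n bS(1)] bS(2) by auto
      moreover obtain a where a: "a \<in> P (s n)" "infdist b (P (s n)) = dist b a"
        using infdist_attains_inf[OF compact_imp_closed[OF P(2)] P(3)] by metis
      moreover have "a \<in> S2" using a(1) P(1) by blast
      ultimately have "rho a b < e"
        using d(2)[of a b] bS(1) by (simp add: dist_commute)
      then show "\<exists>a\<in>(P \<circ> s) n. rho a b < e" using a(1) by auto
    qed
  qed
  with s pts show thesis using that by blast
qed

section \<open>Annuli between circles and the pairs they produce\<close>

lemma rho_self:
  assumes "x \<in> S2"
  shows "rho x x = 0"
proof -
  have "x \<bullet> x = 1"
    using assms by (auto simp: norm_eq_1)
  then show ?thesis by (simp add: rho_def)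
qed

text \<open>\<open>U\<close> and the union of the two open caps are disjoint, relatively open, and
  cover the complement of the circles; this makes the connected set \<open>U\<close> a full
  component. Its closure adds both circles, since each of their points is a limit of points of
  \<open>U\<close>.\<close>

lemma annulus_is_U:
  assumes x: "x \<in> S2" and y: "y \<in> S2" and r: "0 < r" "r < rho x y / 2"
  defines "U \<equiv> {w \<in> S2. r < rho x w \<and> r < rho y w}"
  shows "is_U {w \<in> S2. rho x w = r} {w \<in> S2. rho y w = r} U"
    "closure U = S2 - (Dball r x \<union> Dball r y)"
proof -
  define J1 where "J1 = {w \<in> S2. rho x w = r}"
  define J2 where "J2 = {w \<in> S2. rho y w = r}"
  define A where "A = {w \<in> S2. r \<le> rho x w \<and> r \<le> rho y w}"
  have clA: "closed A"
  proof -
    have "A = (S2 \<inter> rho x -` {r..}) \<inter> (S2 \<inter> rho y -` {r..})"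
      by (auto simp: A_def)
    then show ?thesis
      using continuous_closed_preimage[OF continuous_on_rho[OF x] closed_sphere closed_atLeast]
        continuous_closed_preimage[OF continuous_on_rho[OF y] closed_sphere closed_atLeast]
      by (metis closed_Int)
  qed
  have opU: "openin (top_of_set S2) U"
  proof -
    have "U = (S2 \<inter> rho x -` {r<..}) \<inter> (S2 \<inter> rho y -` {r<..})"
      by (auto simp: U_def)
    then show ?thesis
      using continuous_openin_preimage_gen[OF continuous_on_rho[OF x] open_greaterThan]
        continuous_openin_preimage_gen[OF continuous_on_rho[OF y] open_greaterThan]
      by (metis openin_Int)
  qed
  have "J1 \<subseteq> closure U"
    unfolding J1_def U_def by (rule circle_subset_closure_annulus[OF x y r])
  moreover have "J2 \<subseteq> closure U"
    using circle_subset_closure_annulus[OF y x r(1)] r(2) rho_commute[of x y]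
    unfolding J2_def U_def by (simp add: conj_commute)
  moreover have "U \<subseteq> A" "A \<subseteq> U \<union> (J1 \<union> J2)"
    by (auto simp: U_def A_def J1_def J2_def)
  ultimately have "closure U = A"
    using clA closure_subset[of U] closure_minimal[of U A] by blast
  moreover have "A = S2 - (Dball r x \<union> Dball r y)"
    by (auto simp: A_def Dball_def)
  ultimately show "closure U = S2 - (Dball r x \<union> Dball r y)"
    by simp
  have rr: "\<not> (rho x w \<le> r \<and> rho y w \<le> r)" if "w \<in> S2" for w
    using rho_triangle[OF x y that] rho_commute[of w y] r by auto
  have "sbd U = J1 \<union> J2"
    unfolding sbd_eq[OF opU] \<open>closure U = A\<close>
    using rr by (force simp: U_def A_def J1_def J2_def)
  moreover have "U \<in> components (S2 - (J1 \<union> J2))"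
    unfolding in_components_maximal
  proof (intro conjI allI impI)
    obtain F :: "real \<Rightarrow> complex \<Rightarrow> real^3" where F:
      "\<And>t z. cmod z = 1 \<Longrightarrow> F t z \<in> S2"
      "\<And>t z. cmod z = 1 \<Longrightarrow> 0 \<le> t \<Longrightarrow> t \<le> pi \<Longrightarrow> rho x (F t z) = t"
      using polar_coordinates[OF x] by metis
    have "r \<le> pi" using r rho_bounds[OF x y] by auto
    then have "F r 1 \<in> J1"
      using F(1)[of 1 r] F(2)[of 1 r] r(1) by (simp add: J1_def)
    then show "U \<noteq> {}"
      using \<open>J1 \<subseteq> closure U\<close> by force
    show "U \<subseteq> S2 - (J1 \<union> J2)"
      by (auto simp: U_def J1_def J2_def)
    show "connected U"
      unfolding U_def by (rule connected_annulus[OF x y r])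
    fix C assume C: "C \<noteq> {} \<and> U \<subseteq> C \<and> C \<subseteq> S2 - (J1 \<union> J2) \<and> connected C"
    have "openin (top_of_set S2) (Dball r x \<union> Dball r y)"
      using openin_Dball x y by (simp add: openin_Un)
    then obtain T2 where T2: "open T2" "Dball r x \<union> Dball r y = S2 \<inter> T2"
      by (metis openin_open)
    obtain T1 where T1: "open T1" "U = S2 \<inter> T1"
      using opU by (metis openin_open)
    have cov: "S2 - (J1 \<union> J2) \<subseteq> U \<union> (Dball r x \<union> Dball r y)" "U \<inter> (Dball r x \<union> Dball r y) = {}"
      by (auto simp: U_def J1_def J2_def Dball_def)
    have "T1 \<inter> C = {} \<or> T2 \<inter> C = {}"
    proof (rule connectedD)
      show "C \<subseteq> T1 \<union> T2" using C cov(1) T1(2) T2(2) by blast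
      show "T1 \<inter> T2 \<inter> C = {}" using C cov(2) T1(2) T2(2) by blast
    qed (use C T1 T2 in auto)
    moreover have "T1 \<inter> C \<noteq> {}" using C \<open>U \<noteq> {}\<close> T1(2) by blast
    ultimately have "T2 \<inter> C = {}" by blast
    then have "C \<subseteq> U" using C cov(1) T2(2) by blast
    then show "C = U" using C by blast
  qed
  ultimately show "is_U {w \<in> S2. rho x w = r} {w \<in> S2. rho y w = r} U"
    by (simp add: is_U_def J1_def J2_def)
qed

text \<open>The circles of radius \<open>r\<close> serve as the two curves and the crossing
  components as the sequence. The pair is a limit of contact points on the circles, hence within
  \<open>r\<close> of \<open>(x, y)\<close> in each coordinate.\<close>

lemma schoenflies_rel_near:
  assumes K: "K \<subseteq> S2" "compact K" and x: "x \<in> S2" and y: "y \<in> S2" and r: "0 < r" "r < rho x y / 2"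
    and inf: "infinite {P \<in> components (K - (Dball r x \<union> Dball r y)).
                   P \<inter> sbd (Dball r x) \<noteq> {} \<and> P \<inter> sbd (Dball r y) \<noteq> {}}" (is "infinite ?CC")
  obtains u v where "(u, v) \<in> schoenflies_rel K" "dist u x \<le> r" "dist v y \<le> r"
proof -
  define J1 where "J1 = {w \<in> S2. rho x w = r}"
  define J2 where "J2 = {w \<in> S2. rho y w = r}"
  define U where "U = {w \<in> S2. r < rho x w \<and> r < rho y w}"
  have isU: "is_U J1 J2 U" and clU: "closure U = S2 - (Dball r x \<union> Dball r y)"
    using annulus_is_U[OF x y r] by (simp_all add: J1_def J2_def U_def)
  have rpi: "r < pi"
    using r rho_bounds[OF x y] by auto
  have scc: "simple_closed_curve J1" "simple_closed_curve J2"
    unfolding J1_def J2_def using simple_closed_curve_circle x y r(1) rpi by blast+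
  have disj: "J1 \<inter> J2 = {}"
  proof -
    have "rho x w \<noteq> r \<or> rho y w \<noteq> r" if "w \<in> S2" for w
      using rho_triangle[OF x y that] rho_commute[of w y] r by auto
    then show ?thesis by (auto simp: J1_def J2_def)
  qed
  have sbd: "sbd (Dball r v) \<subseteq> {w \<in> S2. rho v w = r}" if "v \<in> S2" for v
  proof -
    have "closure (Dball r v) \<subseteq> {w \<in> S2. rho v w \<le> r}"
      by (rule closure_minimal[OF _ closed_rho_le[OF that]]) (auto simp: Dball_def)
    then show ?thesis
      unfolding sbd_eq[OF openin_Dball[OF that]] by (force simp: Dball_def)
  qed
  have eq: "closure U \<inter> K = K - (Dball r x \<union> Dball r y)"
    using clU K(1) by blast
  obtain P :: "nat \<Rightarrow> (real^3) set" where P: "inj P" "range P \<subseteq> ?CC"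
    using infinite_countable_subset[OF inf] by blast
  have Pc: "P n \<in> components (closure U \<inter> K)" "P n \<inter> J1 \<noteq> {}" "P n \<inter> J2 \<noteq> {}" for n
  proof -
    have "P n \<in> ?CC" using P(2) by blast
    then show "P n \<in> components (closure U \<inter> K)" "P n \<inter> J1 \<noteq> {}" "P n \<inter> J2 \<noteq> {}"
      using sbd[OF x] sbd[OF y] unfolding eq J1_def J2_def by blast+
  qed
  have "compact (closure U \<inter> K)"
    using K(2) by (simp add: closed_Int_compact)
  then have Pk: "compact (P n)" "P n \<subseteq> K" for n
    using compact_components[OF _ Pc(1)] in_components_subset[OF Pc(1)] by blast+
  have "\<forall>n. \<exists>a. a \<in> P n \<inter> J1" "\<forall>n. \<exists>a. a \<in> P n \<inter> J2"
    using Pc(2,3) by blast+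
  then obtain p q where p: "\<And>n. p n \<in> P n \<inter> J1" and q: "\<And>n. q n \<in> P n \<inter> J2"
    by metis
  \<comment> \<open>Compactness of the product yields one subsequence along which both contact
    points converge.\<close>
  have cJ: "compact (J1 \<times> J2)"
    using scc unfolding simple_closed_curve_def by (metis compact_Times compact_simple_path_image)
  have "\<forall>n. (p n, q n) \<in> J1 \<times> J2"
    using p q by blast
  then obtain l t where t: "l \<in> J1 \<times> J2" "strict_mono (t :: nat \<Rightarrow> nat)" "((\<lambda>n. (p n, q n)) \<circ> t) \<longlonglongrightarrow> l"
    using cJ unfolding compact_def by meson
  define u v where "u = fst l" and "v = snd l"
  have uv: "u \<in> J1" "v \<in> J2"
    using t(1) by (auto simp: u_def v_def)
  have lim: "(\<lambda>n. p (t n)) \<longlonglongrightarrow> u" "(\<lambda>n. q (t n)) \<longlonglongrightarrow> v"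
    using tendsto_fst[OF t(3)] tendsto_snd[OF t(3)] by (simp_all add: u_def v_def o_def)
  have PS: "P n \<subseteq> S2" for n using Pk(2) K(1) by blast
  \<comment> \<open>A second subsequence makes the components converge; \<open>u\<close> and
    \<open>v\<close>, being limits of points chosen from them, belong to the Hausdorff
    limit.\<close>
  obtain s L where s: "strict_mono s" "hausdorff_lim ((\<lambda>n. P (t n)) \<circ> s) L"
    and L: "\<And>p l. (\<And>n. p n \<in> P (t n)) \<Longrightarrow> p \<longlonglongrightarrow> l \<Longrightarrow> l \<in> L"
    using hausdorff_lim_subsequence[of "\<lambda>n. P (t n)"] PS Pk(1) Pc(2) by (metis inf_bot_left)
  have "{u, v} \<subseteq> L"
    using L[OF _ lim(1)] L[OF _ lim(2)] p q by blast
  have "u \<in> K" "v \<in> K"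
    using closed_sequentially[OF compact_imp_closed[OF K(2)] _ lim(1)]
      closed_sequentially[OF compact_imp_closed[OF K(2)] _ lim(2)] p q Pk(2) by blast+
  have "u \<noteq> v" using uv disj by blast
  have "J1 \<subseteq> S2" "J2 \<subseteq> S2" by (auto simp: J1_def J2_def)
  define Q where "Q = (\<lambda>n. P (t n)) \<circ> s"
  have "inj Q"
    using inj_compose[OF inj_compose[OF P(1) strict_mono_imp_inj_on[OF t(2)]]
        strict_mono_imp_inj_on[OF s(1)]] by (simp add: o_def Q_def)
  have Qc: "\<forall>n. Q n \<in> components (closure U \<inter> K) \<and> Q n \<inter> J1 \<noteq> {} \<and> Q n \<inter> J2 \<noteq> {}"
    using Pc by (simp add: Q_def)
  have "hausdorff_lim Q L"
    using s(2) by (simp add: Q_def)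
  have "(u, v) \<in> schoenflies_rel K"
    unfolding schoenflies_rel_def
    by (rule CollectI, rule exI[of _ u], rule exI[of _ v],
        rule conjI[OF refl], rule conjI[OF \<open>u \<in> K\<close>], rule conjI[OF \<open>v \<in> K\<close>], rule conjI[OF \<open>u \<noteq> v\<close>],
        rule exI[of _ J1], rule exI[of _ J2], rule exI[of _ U], intro conjI,
        (fact \<open>J1 \<subseteq> S2\<close> \<open>J2 \<subseteq> S2\<close> scc disj uv isU)+,
        rule exI[of _ Q], intro conjI, fact \<open>inj Q\<close>, fact Qc,
        rule exI[of _ L], intro conjI, fact \<open>hausdorff_lim Q L\<close>, fact \<open>{u, v} \<subseteq> L\<close>)
  moreover have "dist u x \<le> r" "dist v y \<le> r"
    using uv dist_le_rho[OF x, of u] dist_le_rho[OF y, of v] by (auto simp: J1_def J2_def dist_commute)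
  ultimately show thesis using that by blast
qed

theorem theorem3:
  fixes K :: "(real^3) set" and x y :: "real^3"
  assumes "K \<subseteq> S2" and "compact K" and "x \<in> K" and "y \<in> K" and "x \<noteq> y"
  shows "(x, y) \<in> closure (schoenflies_rel K) \<longleftrightarrow>
    (\<forall>r. 0 < r \<and> r < rho x y / 2 \<longrightarrow>
       infinite {P \<in> components (K - (Dball r x \<union> Dball r y)).
                   P \<inter> sbd (Dball r x) \<noteq> {} \<and> P \<inter> sbd (Dball r y) \<noteq> {}})"
proof
  have xy: "x \<in> S2" "y \<in> S2" using assms by blast+
  assume cl: "(x, y) \<in> closure (schoenflies_rel K)"
  show "\<forall>r. 0 < r \<and> r < rho x y / 2 \<longrightarrow>
       infinite {P \<in> components (K - (Dball r x \<union> Dball r y)).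
                   P \<inter> sbd (Dball r x) \<noteq> {} \<and> P \<inter> sbd (Dball r y) \<noteq> {}}"
  proof (intro allI impI)
    fix r assume r: "0 < r \<and> r < rho x y / 2"
    \<comment> \<open>The closure is taken in the ambient product space, which agrees with the
      closure in \<open>K \<times> K\<close> because \<open>K\<close> is compact. The caps are open
      only in the sphere, so they are cut out of it by the ambient open sets \<open>T1\<close> and
      \<open>T2\<close>.\<close>
    obtain T1 where T1: "open T1" "Dball r x = S2 \<inter> T1"
      using openin_Dball[OF xy(1)] by (metis openin_open)
    obtain T2 where T2: "open T2" "Dball r y = S2 \<inter> T2"
      using openin_Dball[OF xy(2)] by (metis openin_open)
    have "x \<in> Dball r x" "y \<in> Dball r y"
      using xy r rho_self by (auto simp: Dball_def)
    then have "(x, y) \<in> T1 \<times> T2" using T1(2) T2(2) by blast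
    moreover have "open (T1 \<times> T2)" using T1(1) T2(1) by (rule open_Times)
    ultimately have "(T1 \<times> T2) \<inter> schoenflies_rel K \<noteq> {}"
      using cl open_Int_closure_eq_empty[of "T1 \<times> T2" "schoenflies_rel K"] by blast
    then obtain u v where uv: "(u, v) \<in> schoenflies_rel K" "u \<in> T1" "v \<in> T2" by auto
    then have "u \<in> K" "v \<in> K" by (auto simp: schoenflies_rel_def)
    then have "u \<in> Dball r x" "v \<in> Dball r y"
      using uv T1(2) T2(2) assms(1) by blast+
    then show "infinite {P \<in> components (K - (Dball r x \<union> Dball r y)).
                   P \<inter> sbd (Dball r x) \<noteq> {} \<and> P \<inter> sbd (Dball r y) \<noteq> {}}"
      using infinite_crossing_of_schoenflies_rel[OF assms(1,2) xy _ uv(1)] r by blast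
  qed
next
  have xy: "x \<in> S2" "y \<in> S2" using assms by blast+
  assume inf: "\<forall>r. 0 < r \<and> r < rho x y / 2 \<longrightarrow>
       infinite {P \<in> components (K - (Dball r x \<union> Dball r y)).
                   P \<inter> sbd (Dball r x) \<noteq> {} \<and> P \<inter> sbd (Dball r y) \<noteq> {}}"
  have "0 < dist x y" using assms(5) by simp
  then have pos: "rho x y > 0"
    using dist_le_rho[OF xy] by linarith
  show "(x, y) \<in> closure (schoenflies_rel K)"
    unfolding closure_approachable
  proof (intro allI impI)
    fix e :: real assume e: "e > 0"
    \<comment> \<open>Both coordinates within \<open>e / 3\<close> put the pair within
      \<open>2 * e / 3\<close>, and a quarter of \<open>rho x y\<close> is an admissible
      radius.\<close>
    define r where "r = min (e / 3) (rho x y / 4)"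
    have r: "0 < r" "r < rho x y / 2" "r \<le> e / 3"
      using e pos by (auto simp: r_def)
    obtain u v where uv: "(u, v) \<in> schoenflies_rel K" "dist u x \<le> r" "dist v y \<le> r"
      using schoenflies_rel_near[OF assms(1,2) xy r(1,2)] inf r(1,2) by blast
    have "dist (u, v) (x, y) \<le> dist u x + dist v y"
      unfolding dist_Pair_Pair by (rule sqrt_sum_squares_le_sum) auto
    also have "\<dots> < e" using uv(2,3) r(3) e by linarith
    finally show "\<exists>z\<in>schoenflies_rel K. dist z (x, y) < e"
      using uv(1) by blast
  qed
qed

end
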